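(* Let $p,q$ be squarefree positive integers such that $K=\mathbb{Q}(\sqrt p,\sqrt q)$ is a biquadratic number field, let $r=\frac{pq}{\gcd(p,q)^2}$, and assume that $(p,q)$ falls into one of the following cases: (1) $p\equiv 2$, $q\equiv 3 \pmod 4$; (2) $p\equiv 2$, $q\equiv 1\pmod 4$; (3) $p\equiv 3$, $q\equiv 1\pmod 4$; (4) $p\equiv 1$, $q\equiv 1\pmod 4$. For $k\in\{p,q,r\}$, write the continued fraction of $-\overline{\omega_k}$ as $[u_0,\overline{u_1,u_2,\dots,u_{s-1},u_s}]$ (so that $u_{i+s}=u_i$ for all $i\ge 1$), and set $M_k=\max\{u_i : i \text{ odd}\}$. (a) Let $\alpha\in\mathbb{Q}(\sqrt p)$ be indecomposable in $\mathbb{Q}(\sqrt p)$. - If $\alpha$ is a convergent of $-\overline{\omega_p}$ and $\sqrt r>\sqrt p$, then $\alpha$ is indecomposable in $K$. - If $\sqrt r>M_p\sqrt p$, then $\alpha$ is indecomposable in $K$. (b) Let $\beta\in\mathbb{Q}(\sqrt q)$ be indecomposable in $\mathbb{Q}(\sqrt q)$. - In cases (1), (2), (3), $\beta$ is indecomposable in $K$. - In case (4), if $\sqrt r>\sqrt q$ and $\beta$ is a convergent of $-\overline{\omega_q}$, then $\beta$ is indecomposable in $K$. - In case (4), if $\sqrt r>M_q\sqrt q$, then $\beta$ is indecomposable in $K$. (c) Let $\gamma\in\mathbb{Q}(\sqrt r)$ be indecomposable in $\mathbb{Q}(\sqrt r)$. - If $\gamma$ is a convergent of $-\overline{\omega_r}$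 and $\sqrt p>\sqrt r$, then $\gamma$ is indecomposable in $K$. - If $\sqrt p>M_r\sqrt r$, then $\gamma$ is indecomposable in $K$.
   Context: For a totally real number field $F$, $\mathcal{O}_F$ is its ring of integers and $\mathcal{O}_F^+$ is the set of totally positive integers, i.e. elements $\alpha\in\mathcal{O}_F$ with $\sigma(\alpha)>0$ for every embedding $\sigma$ of $F$ into $\mathbb{C}$. An element $\alpha\in\mathcal{O}_F^+$ is called indecomposable (in $F$) if it cannot be written as $\alpha=\beta+\gamma$ with $\beta,\gamma\in\mathcal{O}_F^+$. A biquadratic field $\mathbb{Q}(\sqrt p,\sqrt q)$ has degree $4$ over $\mathbb{Q}$; its quadratic subfields are $\mathbb{Q}(\sqrt p)$, $\mathbb{Q}(\sqrt q)$, $\mathbb{Q}(\sqrt r)$. For a squarefree integer $k>1$, put $\omega_k=\sqrt k$ if $k\equiv 2,3\pmod 4$ and $\omega_k=\frac{1+\sqrt k}{2}$ if $k\equiv 1\pmod 4$; $\overline{\omega_k}$ is its Galois conjugate in $\mathbb{Q}(\sqrt k)$. The number $-\overline{\omega_k}$ has an eventually periodic continued fraction $[u_0,\overline{u_1,\dots,u_s}]$. With $\frac{x_i}{y_i}=[u_0,\dots,u_i]$ (in lowest terms, $y_i>0$, $i\ge 0$) denoting the usual convergents, an algebraic integer is called a convergent of $-\overline{\omega_k}$ if it equals $\alpha_i=x_i+y_i\omega_k$ for some $i$. *)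

theory Defs
  imports Complex_Main "HOL-Algebra.Generated_Fields" "HOL-Algebra.Embedded_Algebras"
    "HOL-Algebra.Algebraic_Closure_Type"
    "HOL-Computational_Algebra.Squarefree"
begin

section \<open>Real number fields\<close>

text \<open>
  The number fields below are subfields of the real numbers.  For reals, the field generated by a
  set \<open>S\<close> is \<open>\<rat>(S)\<close>, since the prime field is \<open>\<rat>\<close>.
\<close>

abbreviation real_ring :: "real ring" where
  "real_ring \<equiv> ring_of_type_algebra"

abbreviation complex_ring :: "complex ring" where
  "complex_ring \<equiv> ring_of_type_algebra"

definition rat_adjoin :: "real set \<Rightarrow> real set" where
  "rat_adjoin S = generate_field real_ring S"

definition has_rat_degree :: "real set \<Rightarrow> nat \<Rightarrow> bool" where
  "has_rat_degree F n \<longleftrightarrow> ring.dimension real_ring n \<rat> F"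

text \<open>
  Embeddings are functions on all reals, of which only the values on \<open>F\<close> matter.
\<close>

definition embeddings :: "real set \<Rightarrow> (real \<Rightarrow> complex) set" where
  "embeddings F = ring_hom (real_ring\<lparr>carrier := F\<rparr>) complex_ring"

definition integers_of :: "real set \<Rightarrow> real set" where
  "integers_of F = {x \<in> F. algebraic_int x}"

definition pos_integers_of :: "real set \<Rightarrow> real set" where
  "pos_integers_of F =
     {x \<in> integers_of F. \<forall>\<sigma> \<in> embeddings F. \<sigma> x \<in> \<real> \<and> Re (\<sigma> x) > 0}"

definition indecomposable_in :: "real set \<Rightarrow> real \<Rightarrow> bool" where
  "indecomposable_in F x \<longleftrightarrow>
     x \<in> pos_integers_of F \<and>
     \<not> (\<exists>y \<in> pos_integers_of F. \<exists>z \<in> pos_integers_of F. x = y + z)"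

section \<open>Continued fractions\<close>

text \<open>
  The quotients and convergents are meant for irrational \<open>x\<close>, where the expansion does not stop
  and no division by zero occurs.
\<close>

fun complete_quotient :: "real \<Rightarrow> nat \<Rightarrow> real" where
  "complete_quotient x 0 = x"
| "complete_quotient x (Suc i) = 1 / frac (complete_quotient x i)"

definition partial_quotient :: "real \<Rightarrow> nat \<Rightarrow> int" where
  "partial_quotient x i = \<lfloor>complete_quotient x i\<rfloor>"

fun cf_value :: "int list \<Rightarrow> rat" where
  "cf_value [] = 0"
| "cf_value [u] = of_int u"
| "cf_value (u # v # us) = of_int u + 1 / cf_value (v # us)"

definition cf_convergent :: "real \<Rightarrow> nat \<Rightarrow> rat" where
  "cf_convergent x i = cf_value (map (partial_quotient x) [0..<Suc i])"

definition omega :: "nat \<Rightarrow> real" where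
  "omega k = (if k mod 4 = 1 then (1 + sqrt (real k)) / 2 else sqrt (real k))"

definition omega_conj :: "nat \<Rightarrow> real" where
  "omega_conj k = (if k mod 4 = 1 then (1 - sqrt (real k)) / 2 else - sqrt (real k))"

text \<open>
  \<^const>\<open>quotient_of\<close> returns numerator and denominator in lowest terms, with positive
  denominator.
\<close>

definition omega_convergent :: "nat \<Rightarrow> nat \<Rightarrow> real" where
  "omega_convergent k i =
     (let (x, y) = quotient_of (cf_convergent (- omega_conj k) i)
      in of_int x + of_int y * omega k)"

definition is_omega_convergent :: "nat \<Rightarrow> real \<Rightarrow> bool" where
  "is_omega_convergent k a \<longleftrightarrow> (\<exists>i. a = omega_convergent k i)"

text \<open>
  For squarefree \<open>k > 1\<close> the expansion is eventually periodic, so this is the maximum of a finite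
  nonempty set.
\<close>

definition M_odd :: "nat \<Rightarrow> int" where
  "M_odd k = Max {partial_quotient (- omega_conj k) i | i. odd i}"

end

theory Submission
  imports Defs "Jordan_Normal_Form.Char_Poly"
begin

text \<open>
  Let \<open>k\<close> be one of \<open>p, q, r\<close>, let \<open>\<alpha>\<close> be indecomposable in \<open>\<rat>(\<surd>k)\<close> and suppose \<open>\<alpha> = y + z\<close> in \<open>K\<close>. The
  components of \<open>y\<close> and \<open>z\<close> outside \<open>\<rat>(\<surd>k)\<close> are opposite, say \<open>\<delta>\<close> and \<open>-\<delta>\<close>, and total positivity
  bounds \<open>2\<bar>\<delta>\<bar>\<close> by \<open>\<alpha>\<close> at every embedding. With \<open>m\<close> another of the three radicands,
  \<open>\<eta> = 2\<delta> \<surd>k / \<surd>m\<close> is an integer of \<open>\<rat>(\<surd>k)\<close>, by integrality of the relative traces of \<open>y\<close>, and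
  \<open>\<surd>m / \<surd>k \<cdot> \<bar>\<eta>\<bar> < \<alpha>\<close> holds at both embeddings. In the basis of two consecutive convergents of
  the continued fraction of \<open>-\<omega>\<^sub>k'\<close> one sees that there is no nonzero such lattice point: for a
  convergent \<open>\<alpha>\<close> as soon as the factor exceeds \<open>1\<close>, and for an intermediate \<open>\<alpha>\<close> as soon as it
  exceeds the partial quotients of odd index. Hence \<open>\<delta> = 0\<close>, and \<open>\<alpha>\<close> decomposes in \<open>\<rat>(\<surd>k)\<close>.

  In part (b), cases (1) to (3), half of the relative trace to \<open>\<rat>(\<surd>q)\<close> is already integral, as a
  computation modulo 4 with the relative norm to \<open>\<rat>(\<surd>p)\<close> shows; it maps a decomposition in \<open>K\<close> to
  one in \<open>\<rat>(\<surd>q)\<close>.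
\<close>

section \<open>Sums and products of algebraic integers\<close>

text \<open>A finitely generated subgroup of the reals. A number that multiplies a nonzero such
  group into itself is an algebraic integer; sums and products are treated through this
  criterion.\<close>

definition int_span :: "nat \<Rightarrow> (nat \<Rightarrow> real) \<Rightarrow> real set" where
  "int_span N v = range (\<lambda>c :: nat \<Rightarrow> int. \<Sum>k<N. of_int (c k) * v k)"

lemma int_spanI: "a = (\<Sum>k<N. of_int (c k) * v k) \<Longrightarrow> a \<in> int_span N v"
  unfolding int_span_def by (rule image_eqI) auto

lemma int_span_add:
  assumes "a \<in> int_span N v" "b \<in> int_span N v"
  shows "a + b \<in> int_span N v"
proof -
  obtain c d :: "nat \<Rightarrow> int" where "a = (\<Sum>k<N. of_int (c k) * v k)" "b = (\<Sum>k<N. of_int (d k) * v k)"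
    using assms by (auto simp: int_span_def)
  then have "a + b = (\<Sum>k<N. of_int (c k + d k) * v k)"
    by (simp add: sum.distrib algebra_simps)
  then show ?thesis by (rule int_spanI)
qed

lemma int_span_scale:
  assumes "a \<in> int_span N v"
  shows "of_int m * a \<in> int_span N v"
proof -
  obtain c :: "nat \<Rightarrow> int" where "a = (\<Sum>k<N. of_int (c k) * v k)"
    using assms by (auto simp: int_span_def)
  then have "of_int m * a = (\<Sum>k<N. of_int (m * c k) * v k)"
    by (simp add: sum_distrib_left algebra_simps)
  then show ?thesis by (rule int_spanI)
qed

lemma int_span_0: "0 \<in> int_span N v"
proof -
  have "0 = (\<Sum>k<N. of_int ((\<lambda>_. 0) k) * v k)" by simp
  then show ?thesis by (rule int_spanI)
qed

lemma int_span_sum: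
  assumes "\<And>i. i \<in> I \<Longrightarrow> f i \<in> int_span N v"
  shows "sum f I \<in> int_span N v"
  using assms by (induction I rule: infinite_finite_induct) (auto intro: int_span_add int_span_0)

lemma int_span_gen:
  assumes "k < N" shows "v k \<in> int_span N v"
proof -
  have "(\<Sum>j<N. of_int (if j = k then 1 else 0) * v j) = (\<Sum>j<N. if j = k then v j else 0)"
    by (intro sum.cong) auto
  also have "\<dots> = v k" using assms by (simp add: sum.delta)
  finally have "v k = (\<Sum>j<N. of_int (if j = k then 1 else 0) * v j)" by simp
  then show ?thesis by (rule int_spanI)
qed

lemma int_span_mult_closed:
  assumes "\<And>k. k < N \<Longrightarrow> x * v k \<in> int_span N v" and "a \<in> int_span N v"
  shows "x * a \<in> int_span N v"
proof -
  obtain c :: "nat \<Rightarrow> int" where "a = (\<Sum>k<N. of_int (c k) * v k)"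
    using assms by (auto simp: int_span_def)
  then have "x * a = (\<Sum>k<N. of_int (c k) * (x * v k))"
    by (simp add: sum_distrib_left algebra_simps)
  then show ?thesis using assms(1) by (auto intro!: int_span_sum int_span_scale)
qed

text \<open>The multiplier is an eigenvalue of an integer matrix, so it is a root of its characteristic
  polynomial.\<close>

lemma algebraic_int_if_int_span_stable:
  assumes stable: "\<And>k. k < N \<Longrightarrow> z * v k \<in> int_span N v" and nz: "k0 < N" "v k0 \<noteq> 0"
  shows "algebraic_int z"
proof -
  have "\<forall>k. \<exists>c :: nat \<Rightarrow> int. k < N \<longrightarrow> z * v k = (\<Sum>j<N. of_int (c j) * v j)"
    using stable unfolding int_span_def by blast
  then obtain A :: "nat \<Rightarrow> nat \<Rightarrow> int"
    where A: "\<And>k. k < N \<Longrightarrow> z * v k = (\<Sum>j<N. of_int (A k j) * v j)" by metis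
  define B where "B = mat N N (\<lambda>(i, j). A i j)"
  define BR where "BR = map_mat real_of_int B"
  define w where "w = vec N v"
  have B: "B \<in> carrier_mat N N" and BR: "BR \<in> carrier_mat N N" by (auto simp: B_def BR_def)
  have w: "w \<in> carrier_vec N" by (simp add: w_def)
  have "w \<noteq> 0\<^sub>v N"
    using nz by (metis index_vec index_zero_vec(1) w_def)
  moreover have "BR *\<^sub>v w = z \<cdot>\<^sub>v w"
    by (rule eq_vecI) (use A in \<open>auto simp: w_def BR_def B_def scalar_prod_def lessThan_atLeast0\<close>)
  ultimately have "eigenvector BR w z"
    unfolding eigenvector_def using w BR by auto
  then have "poly (char_poly BR) z = 0"
    using eigenvalue_root_char_poly[OF BR] eigenvalue_def by blast
  moreover have "char_poly BR = map_poly of_int (char_poly B)"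
    unfolding BR_def using of_int_hom.char_poly_hom[OF B] by simp
  moreover have "lead_coeff (char_poly B) = 1"
    using degree_monic_char_poly[OF B] by simp
  ultimately show ?thesis
    unfolding algebraic_int_altdef_ipoly by metis
qed

text \<open>The monic integer equation of \<open>x\<close> is solved for its leading power;
  \<open>m > 0\<close> because the constant polynomial 1 has no root.\<close>

lemma algebraic_int_power_reduction:
  fixes x :: real
  assumes "algebraic_int x"
  obtains m and a :: "nat \<Rightarrow> int" where "m > 0" "x ^ m = (\<Sum>i<m. of_int (a i) * x ^ i)"
proof -
  obtain p where p: "poly (map_poly of_int p) x = 0" "lead_coeff p = (1 :: int)"
    using assms unfolding algebraic_int_altdef_ipoly by blast
  define m where "m = degree p"
  have "degree (map_poly real_of_int p) = m" by (simp add: m_def)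
  then have "0 = (\<Sum>i\<le>m. real_of_int (coeff p i) * x ^ i)"
    using p(1) by (simp add: poly_altdef coeff_map_poly)
  also have "\<dots> = (\<Sum>i<m. real_of_int (coeff p i) * x ^ i) + x ^ m"
    using p(2) by (simp add: lessThan_Suc_atMost[symmetric] m_def)
  finally have "x ^ m = - (\<Sum>i<m. real_of_int (coeff p i) * x ^ i)" by linarith
  also have "\<dots> = (\<Sum>i<m. of_int (- coeff p i) * x ^ i)" by (simp add: sum_negf)
  finally have eq: "x ^ m = (\<Sum>i<m. of_int (- coeff p i) * x ^ i)" .
  have "m > 0"
  proof (rule ccontr)
    assume "\<not> m > 0"
    then have "m = 0" by simp
    from eq[unfolded this] have "(1 :: real) = 0" by (simp only: power_0 lessThan_0 sum.empty)
    then show False by simp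
  qed
  then show ?thesis using eq that[of m "\<lambda>i. - coeff p i"] by blast
qed

text \<open>The monomials \<open>x ^ i * y ^ j\<close> with \<open>i < m\<close> and
  \<open>j < n\<close> span a group stable under \<open>x\<close> and under \<open>y\<close>, hence
  under their sum and product.\<close>

lemma algebraic_int_add_mult:
  fixes x y :: real
  assumes "algebraic_int x" "algebraic_int y"
  shows "algebraic_int (x + y)" "algebraic_int (x * y)"
proof -
  obtain m and a :: "nat \<Rightarrow> int" where m: "m > 0" "x ^ m = (\<Sum>i<m. of_int (a i) * x ^ i)"
    using algebraic_int_power_reduction[OF assms(1)] .
  obtain n and b :: "nat \<Rightarrow> int" where n: "n > 0" "y ^ n = (\<Sum>i<n. of_int (b i) * y ^ i)"
    using algebraic_int_power_reduction[OF assms(2)] .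
  \<comment> \<open>The monomials are listed by a single index,
    \<open>k = i * n + j\<close>.\<close>
  define v where "v k = x ^ (k div n) * y ^ (k mod n)" for k
  define N where "N = m * n"
  have less: "i * n + j < N" if "i < m" "j < n" for i j
  proof -
    have "i * n + j < Suc i * n" using that by simp
    also have "\<dots> \<le> m * n" using that by (intro mult_le_mono1) simp
    finally show ?thesis by (simp add: N_def)
  qed
  have v: "v (i * n + j) = x ^ i * y ^ j" if "j < n" for i j
    using that n by (simp add: v_def)
  have mem: "x ^ i * y ^ j \<in> int_span N v" if "i < m" "j < n" for i j
    using int_span_gen[OF less[OF that], of v] v[OF that(2)] by simp
  have gen: "\<exists>i j. i < m \<and> j < n \<and> v k = x ^ i * y ^ j" if "k < N" for k
    unfolding v_def using that n(1) less_mult_imp_div_less[of k m n] mod_less_divisor[OF n(1), of k]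
    by (auto simp: N_def)
  have x: "x * v k \<in> int_span N v" if "k < N" for k
  proof -
    from gen[OF that] obtain i j where ij: "i < m" "j < n" "v k = x ^ i * y ^ j" by blast
    show ?thesis
    proof (cases "Suc i < m")
      case True
      then show ?thesis using mem[OF True ij(2)] ij by (simp add: mult_ac)
    next
      case False
      \<comment> \<open>Here \<open>i = m - 1\<close>, so the exponent overflows and
        \<open>x ^ m\<close> has to be reduced.\<close>
      then have "x * v k = x ^ m * y ^ j" using ij by (metis Suc_lessI mult.assoc power_Suc)
      also have "\<dots> = (\<Sum>i<m. of_int (a i) * (x ^ i * y ^ j))"
        by (simp add: m sum_distrib_left sum_distrib_right mult_ac)
      finally show ?thesis using mem ij by (auto intro!: int_span_sum int_span_scale)
    qed
  qed
  have y: "y * v k \<in> int_span N v" if "k < N" for k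
  proof -
    from gen[OF that] obtain i j where ij: "i < m" "j < n" "v k = x ^ i * y ^ j" by blast
    show ?thesis
    proof (cases "Suc j < n")
      case True
      then show ?thesis using mem[OF ij(1) True] ij by (simp add: mult_ac)
    next
      case False
      then have "y * v k = y ^ n * x ^ i"
        using ij by (metis Suc_lessI mult.assoc mult.commute power_Suc)
      also have "\<dots> = (\<Sum>j<n. of_int (b j) * (x ^ i * y ^ j))"
        by (simp add: n sum_distrib_left sum_distrib_right mult_ac)
      finally show ?thesis using mem ij by (auto intro!: int_span_sum int_span_scale)
    qed
  qed
  have nz: "0 < N" "v 0 \<noteq> 0" using m n by (auto simp: N_def v_def)
  show "algebraic_int (x + y)"
    by (rule algebraic_int_if_int_span_stable[of N _ v 0])
       (use nz in \<open>auto simp: distrib_right intro!: int_span_add x y\<close>)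
  show "algebraic_int (x * y)"
    by (rule algebraic_int_if_int_span_stable[of N _ v 0])
       (use nz in \<open>auto simp: mult.assoc intro!: int_span_mult_closed x y\<close>)
qed

section \<open>Continued fractions and lattice points\<close>

text \<open>The indices are shifted by one: \<open>cf_num x (Suc i) / cf_den x (Suc i)\<close> is the \<open>i\<close>-th convergent,
  and index \<open>0\<close> stands for the formal convergent \<open>1 / 0\<close>.\<close>

fun cf_num :: "real \<Rightarrow> nat \<Rightarrow> int" and cf_den :: "real \<Rightarrow> nat \<Rightarrow> int" where
  "cf_num x 0 = 1"
| "cf_num x (Suc j) = \<lfloor>x\<rfloor> * cf_num (1 / frac x) j + cf_den (1 / frac x) j"
| "cf_den x 0 = 0"
| "cf_den x (Suc j) = cf_num (1 / frac x) j"

text \<open>\<open>complete_quotient\<close> extends the expansion at its far end, whereas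
  \<open>cf_num\<close> and \<open>cf_value\<close> peel off the first quotient; this translates
  between the two recursions.\<close>

lemma complete_quotient_shift: "complete_quotient x (Suc i) = complete_quotient (1 / frac x) i"
  by (induction i) auto

lemma partial_quotient_shift: "partial_quotient x (Suc i) = partial_quotient (1 / frac x) i"
  by (simp add: partial_quotient_def complete_quotient_shift del: complete_quotient.simps)

lemma partial_quotient_0: "partial_quotient x 0 = \<lfloor>x\<rfloor>"
  by (simp add: partial_quotient_def)

text \<open>The usual three-term recurrence. Since the definition peels off the first quotient, the
  induction runs over all \<open>x\<close> and is applied to \<open>1 / frac x\<close>.\<close>

lemma cf_num_den_Suc_Suc:
  "cf_num x (Suc (Suc j)) = partial_quotient x (Suc j) * cf_num x (Suc j) + cf_num x j \<and>
   cf_den x (Suc (Suc j)) = partial_quotient x (Suc j) * cf_den x (Suc j) + cf_den x j"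
proof (induction j arbitrary: x)
  case 0
  then show ?case by (simp add: partial_quotient_shift partial_quotient_0 mult.commute)
next
  case (Suc j)
  define x' where "x' = 1 / frac x"
  note IH = Suc.IH[of x']
  have "cf_num x (Suc (Suc (Suc j))) = \<lfloor>x\<rfloor> * cf_num x' (Suc (Suc j)) + cf_den x' (Suc (Suc j))"
    by (simp add: x'_def)
  also have "\<dots> = partial_quotient x' (Suc j) * (\<lfloor>x\<rfloor> * cf_num x' (Suc j) + cf_den x' (Suc j))
      + (\<lfloor>x\<rfloor> * cf_num x' j + cf_den x' j)"
    unfolding IH[THEN conjunct1] IH[THEN conjunct2] by (simp add: algebra_simps)
  also have "\<dots> = partial_quotient x (Suc (Suc j)) * cf_num x (Suc (Suc j)) + cf_num x (Suc j)"
    by (simp only: partial_quotient_shift[of x] cf_num.simps(2)[of x] x'_def)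
  finally show ?case
    using IH by (simp add: partial_quotient_shift[of x] x'_def del: cf_num.simps(2))
qed

lemma frac_irrational:
  fixes x :: real assumes "x \<notin> \<rat>"
  shows "0 < frac x" "1 / frac x > 1" "1 / frac x \<notin> \<rat>"
proof -
  have "x \<notin> \<int>" using assms Ints_subset_Rats by blast
  then show pos: "0 < frac x" by (simp add: frac_gt_0_iff)
  then show "1 / frac x > 1" using frac_lt_1[of x] by simp
  have "frac x \<notin> \<rat>"
  proof
    assume "frac x \<in> \<rat>"
    then have "frac x + of_int \<lfloor>x\<rfloor> \<in> \<rat>" by (intro Rats_add) auto
    then show False using assms by (simp add: frac_def)
  qed
  then show "1 / frac x \<notin> \<rat>"
    by (metis Rats_1 Rats_divide div_by_1 divide_divide_eq_right mult_1)
qed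

text \<open>Convergents lie alternately on either side of \<open>x\<close>: passing from
  \<open>1 / frac x\<close> back to \<open>x\<close> multiplies the error by
  \<open>- frac x\<close>.\<close>

lemma cf_error_sign:
  fixes x :: real
  assumes "x \<notin> \<rat>"
  shows "(-1) ^ j * (cf_num x j - x * cf_den x j) > 0"
  using assms
proof (induction j arbitrary: x)
  case 0
  then show ?case by simp
next
  case (Suc j)
  define x' where "x' = 1 / frac x"
  have fx: "frac x > 0" and x': "x' \<notin> \<rat>" using frac_irrational[OF Suc.prems] by (auto simp: x'_def)
  have "cf_num x (Suc j) - x * cf_den x (Suc j) = - frac x * (cf_num x' j - x' * cf_den x' j)"
  proof -
    have "frac x * x' = 1" using fx by (simp add: x'_def)
    then have "- frac x * (a - x' * b) = b - frac x * a" for a b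
      by (simp add: right_diff_distrib flip: mult.assoc)
    moreover have "x * a = \<lfloor>x\<rfloor> * a + frac x * a" for a
      by (simp add: frac_def algebra_simps)
    ultimately show ?thesis by (simp add: x'_def)
  qed
  then have "(-1) ^ Suc j * (cf_num x (Suc j) - x * cf_den x (Suc j))
      = frac x * ((-1) ^ j * (cf_num x' j - x' * cf_den x' j))"
    by simp
  then show ?case using Suc.IH[OF x'] fx by simp
qed

text \<open>The determinant of consecutive convergents. It yields coprimality, and it makes two
  neighbours a basis of the lattice.\<close>

lemma cf_det: "cf_num x (Suc j) * cf_den x j - cf_num x j * cf_den x (Suc j) = (-1) ^ Suc j"
proof (induction j arbitrary: x)
  case 0
  then show ?case by simp
next
  case (Suc j)
  from Suc.IH[of "1 / frac x"] show ?case by (simp add: algebra_simps)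
qed

lemma cf_num_den_pos:
  assumes "x \<notin> \<rat>"
  shows "x > 1 \<Longrightarrow> cf_num x j \<ge> 1" and "x > 0 \<Longrightarrow> cf_num x j \<ge> 0"
    and "cf_den x (Suc j) \<ge> 1" and "cf_den x j \<ge> 0"
proof -
  have *: "(x > 1 \<longrightarrow> cf_num x j \<ge> 1) \<and> cf_den x j \<ge> 0" using assms
  proof (induction j arbitrary: x)
    case 0
    then show ?case by simp
  next
    case (Suc j)
    note fi = frac_irrational[OF Suc.prems]
    note IH = Suc.IH[OF fi(3)]
    have "cf_num x (Suc j) \<ge> 1" if "x > 1"
    proof -
      have "1 * 1 \<le> \<lfloor>x\<rfloor> * cf_num (1 / frac x) j"
        using that IH fi by (intro mult_mono) auto
      then show ?thesis using IH by simp
    qed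
    then show ?case using IH fi by simp
  qed
  then show "x > 1 \<Longrightarrow> cf_num x j \<ge> 1" "cf_den x j \<ge> 0" by auto
  note fi = frac_irrational[OF assms]
  \<comment> \<open>Whatever \<open>x\<close> is, its tail \<open>1 / frac x\<close> exceeds 1, so
    the numerators of the tail are positive; they are the denominators of \<open>x\<close>, one
    index later.\<close>
  have **: "cf_den (1 / frac x) i \<ge> 0 \<and> cf_num (1 / frac x) i \<ge> 1" for i
    using fi(2,3)
  proof (induction i arbitrary: x)
    case 0
    then show ?case by simp
  next
    case (Suc i)
    define y where "y = 1 / frac x"
    have y: "y > 1" "y \<notin> \<rat>" using Suc.prems by (auto simp: y_def)
    note fy = frac_irrational[OF y(2)]
    have IH: "cf_den (1 / frac y) i \<ge> 0" "cf_num (1 / frac y) i \<ge> 1"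
      using Suc.IH[OF fy(2,3)] by auto
    have "1 * 1 \<le> \<lfloor>y\<rfloor> * cf_num (1 / frac y) i"
      using y IH by (intro mult_mono) auto
    then show ?case using IH by (simp add: y_def[symmetric])
  qed
  show "cf_den x (Suc j) \<ge> 1" using **[of j] by simp
  show "x > 0 \<Longrightarrow> cf_num x j \<ge> 0"
    using **[of "j - 1"] by (cases j) auto
qed

lemma partial_quotient_ge_1:
  assumes "x \<notin> \<rat>" shows "partial_quotient x (Suc j) \<ge> 1"
  using assms
proof (induction j arbitrary: x)
  case 0
  then show ?case using frac_irrational[of x] by (simp add: partial_quotient_shift partial_quotient_0)
next
  case (Suc j)
  then show ?case using frac_irrational[of x] by (subst partial_quotient_shift) auto
qed

lemma cf_convergent_eq:
  assumes "x \<notin> \<rat>"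
  shows "cf_convergent x i = of_int (cf_num x (Suc i)) / of_int (cf_den x (Suc i))"
  using assms
proof (induction i arbitrary: x)
  case 0
  then show ?case by (simp add: cf_convergent_def partial_quotient_0)
next
  case (Suc i)
  define x' where "x' = 1 / frac x"
  note fi = frac_irrational[OF Suc.prems, folded x'_def]
  have "map (partial_quotient x) [0..<Suc (Suc i)]
      = partial_quotient x 0 # map (partial_quotient x \<circ> Suc) [0..<Suc i]"
    by (subst upt_conv_Cons) (simp_all add: map_Suc_upt[symmetric] del: upt_Suc)
  also have "partial_quotient x \<circ> Suc = partial_quotient x'"
    by (simp add: fun_eq_iff partial_quotient_shift x'_def)
  finally have "cf_convergent x (Suc i)
      = cf_value (partial_quotient x 0 # map (partial_quotient x') [0..<Suc i])"
    by (simp only: cf_convergent_def)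
  also have "\<dots> = of_int (partial_quotient x 0) + 1 / cf_convergent x' i"
  proof -
    obtain v vs where "map (partial_quotient x') [0..<Suc i] = v # vs"
      by (cases "map (partial_quotient x') [0..<Suc i]") auto
    then show ?thesis by (simp add: cf_convergent_def del: upt_Suc)
  qed
  also have "\<dots> = of_int (cf_num x (Suc (Suc i))) / of_int (cf_den x (Suc (Suc i)))"
  proof -
    have "cf_num x' (Suc i) \<ge> 1" using cf_num_den_pos(1)[OF fi(3,2)] .
    moreover have "cf_num x (Suc (Suc i)) = \<lfloor>x\<rfloor> * cf_num x' (Suc i) + cf_den x' (Suc i)"
      "cf_den x (Suc (Suc i)) = cf_num x' (Suc i)" by (simp_all add: x'_def)
    ultimately show ?thesis
      by (simp add: Suc.IH[OF fi(3)] partial_quotient_0 add_divide_distrib del: cf_num.simps cf_den.simps)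
  qed
  finally show ?case .
qed

text \<open>By \<open>cf_det\<close> some integer combination of numerator and denominator is a
  unit, so the fraction is already in lowest terms.\<close>

lemma quotient_of_cf_convergent:
  assumes "x \<notin> \<rat>"
  shows "quotient_of (cf_convergent x i) = (cf_num x (Suc i), cf_den x (Suc i))"
proof -
  define a b where "a = cf_num x (Suc i)" and "b = cf_den x (Suc i)"
  have "a * cf_den x i - cf_num x i * b = (-1) ^ Suc i" unfolding a_def b_def by (rule cf_det)
  then have "is_unit (a * cf_den x i - cf_num x i * b)" by simp
  then have "coprime a b"
    by (meson coprimeI dvd_diff dvd_mult dvd_mult2 dvd_trans)
  moreover have "b > 0" using cf_num_den_pos(3)[OF assms, of i] by (simp add: b_def)
  ultimately show ?thesis
    unfolding cf_convergent_eq[OF assms]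
    by (simp add: a_def[symmetric] b_def[symmetric] Fract_of_int_quotient[symmetric]
        quotient_of_Fract normalize_stable del: cf_num.simps cf_den.simps)
qed

section \<open>The lattice spanned by 1 and \<omega>, and its convergents\<close>

text \<open>\<open>\<xi>\<close> stands for minus the conjugate of \<open>\<omega>\<close>, so
  \<open>t\<close> is the trace and \<open>s\<close> is minus the norm of \<open>\<omega>\<close>. A
  pair \<open>A\<close>, \<open>B\<close> represents A + B \<omega>, and \<open>val\<close> and
  \<open>cnj_val\<close> are its two embeddings.\<close>

locale cf_lattice =
  fixes \<xi> \<omega> :: real and t s :: int
  assumes irrational: "\<xi> \<notin> \<rat>" and \<xi>_pos: "\<xi> > 0" and \<omega>_ge_1: "\<omega> \<ge> 1"
    and trace: "\<omega> - \<xi> = t" and norm: "\<omega> * \<xi> = s"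
begin

abbreviation u :: "nat \<Rightarrow> int" where "u \<equiv> partial_quotient \<xi>"
abbreviation N :: "nat \<Rightarrow> int" where "N \<equiv> cf_num \<xi>"
abbreviation D :: "nat \<Rightarrow> int" where "D \<equiv> cf_den \<xi>"

definition val :: "int \<Rightarrow> int \<Rightarrow> real" where "val A B = A + B * \<omega>"
definition cnj_val :: "int \<Rightarrow> int \<Rightarrow> real" where "cnj_val A B = A - B * \<xi>"

definition tot_pos :: "int \<Rightarrow> int \<Rightarrow> bool" where
  "tot_pos A B \<longleftrightarrow> val A B > 0 \<and> cnj_val A B > 0"

definition lattice_indecomposable :: "int \<Rightarrow> int \<Rightarrow> bool" where
  "lattice_indecomposable A B \<longleftrightarrow> tot_pos A B \<and>
     \<not> (\<exists>A1 B1 A2 B2. tot_pos A1 B1 \<and> tot_pos A2 B2 \<and> A = A1 + A2 \<and> B = B1 + B2)"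

text \<open>The two embeddings of the convergent with shifted index \<open>j\<close>. Since
  \<open>V\<close> is positive and \<open>C\<close> alternates in sign, the even indices are the
  totally positive ones.\<close>

definition V :: "nat \<Rightarrow> real" where "V j = val (N j) (D j)"
definition C :: "nat \<Rightarrow> real" where "C j = cnj_val (N j) (D j)"

lemma val_comb: "val (c * N i + d * N j) (c * D i + d * D j) = c * V i + d * V j"
  and cnj_val_comb: "cnj_val (c * N i + d * N j) (c * D i + d * D j) = c * C i + d * C j"
  by (simp_all add: val_def cnj_val_def V_def C_def algebra_simps)

lemma C_sign: "(-1) ^ j * C j > 0"
  using cf_error_sign[OF irrational, of j] by (simp add: C_def cnj_val_def mult.commute)

lemma C_even: "C (2 * n) > 0" and C_odd: "C (Suc (2 * n)) < 0"
  using C_sign[of "2 * n"] C_sign[of "Suc (2 * n)"] by auto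

lemma u_ge_1: "u (Suc j) \<ge> 1"
  using partial_quotient_ge_1[OF irrational] .

lemma N_nonneg: "N j \<ge> 0" and D_nonneg: "D j \<ge> 0" and D_pos: "D (Suc j) \<ge> 1"
  using cf_num_den_pos[OF irrational] \<xi>_pos by auto

lemma N_rec: "N (Suc (Suc j)) = u (Suc j) * N (Suc j) + N j"
  and D_rec: "D (Suc (Suc j)) = u (Suc j) * D (Suc j) + D j"
  using cf_num_den_Suc_Suc[of \<xi> j] by auto

lemma V_rec: "V (Suc (Suc j)) = u (Suc j) * V (Suc j) + V j"
  and C_rec: "C (Suc (Suc j)) = u (Suc j) * C (Suc j) + C j"
  by (simp_all add: V_def C_def val_def cnj_val_def N_rec D_rec algebra_simps
      del: cf_num.simps cf_den.simps)

lemma V_pos: "V j > 0"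
proof (cases j)
  case 0
  then show ?thesis by (simp add: V_def val_def)
next
  case (Suc i)
  have "real_of_int (D j) * \<omega> > 0" using D_pos[of i] \<omega>_ge_1 Suc by simp
  moreover have "real_of_int (N j) \<ge> 0" using N_nonneg[of j] by simp
  ultimately show ?thesis by (simp add: V_def val_def)
qed

lemma V_mono: "V j \<le> V (Suc j)"
proof (cases j)
  case 0
  have "\<lfloor>\<xi>\<rfloor> \<ge> 0" using \<xi>_pos by simp
  then have "1 \<le> real_of_int \<lfloor>\<xi>\<rfloor> + \<omega>" using \<omega>_ge_1 by linarith
  then show ?thesis using 0 by (simp add: V_def val_def)
next
  case (Suc i)
  have "1 * V (Suc i) \<le> u (Suc i) * V (Suc i)"
    using u_ge_1[of i] V_pos[of "Suc i"] by (intro mult_right_mono) auto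
  then show ?thesis using V_pos[of i] by (simp add: V_rec Suc)
qed

lemma basis:
  obtains c d where "A = c * N n + d * N (Suc n)" "B = c * D n + d * D (Suc n)"
proof -
  define e :: int where "e = (-1) ^ Suc n"
  have e: "e = N (Suc n) * D n - N n * D (Suc n)" unfolding e_def by (rule cf_det[symmetric])
  have ee: "e * e = 1" by (simp add: e_def flip: power_add)
  \<comment> \<open>Cramer's rule; the determinant \<open>e\<close> is 1 or -1, hence its own
    inverse.\<close>
  define c d where "c = e * (N (Suc n) * B - D (Suc n) * A)" and "d = e * (A * D n - B * N n)"
  have "c * N n + d * N (Suc n) = e * (e * A)" "c * D n + d * D (Suc n) = e * (e * B)"
    unfolding c_def d_def by (subst (3) e; simp add: algebra_simps del: cf_num.simps cf_den.simps)+
  then show ?thesis using that[of c d] ee by (simp flip: mult.assoc)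
qed

text \<open>If \<open>a > 0\<close> and \<open>b <= 0\<close>, nothing cancels in the conjugate,
  because odd convergents have negative conjugates, and the conjugate alone is too large. In the
  remaining cases the value is too large, since \<open>M >= l + 1\<close> and \<open>V\<close> is
  increasing.\<close>

lemma box_no_lattice_point_aux:
  fixes a b l :: int and M :: real
  assumes l: "l \<ge> 0" and M: "M \<ge> l + 1" and nz: "a \<noteq> 0 \<or> b \<noteq> 0"
    and val: "M * \<bar>a * V (2 * n) + b * V (Suc (2 * n))\<bar> < V (2 * n) + l * V (Suc (2 * n))"
    and cnj: "M * \<bar>a * C (2 * n) + b * C (Suc (2 * n))\<bar> < C (2 * n) + l * C (Suc (2 * n))"
    and a: "a \<ge> 0"
  shows False
proof -
  define v w c d where "v = V (2 * n)" and "w = V (Suc (2 * n))"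
    and "c = C (2 * n)" and "d = - C (Suc (2 * n))"
  have vw: "v > 0" "w \<ge> v" using V_pos V_mono by (simp_all add: v_def w_def)
  have cd: "c > 0" "d > 0" using C_even C_odd by (simp_all add: c_def d_def)
  have val: "M * \<bar>a * v + b * w\<bar> < v + l * w" and cnj: "M * \<bar>a * c - b * d\<bar> < c - l * d"
    using val cnj by (simp_all add: v_def w_def c_def d_def)
  have M1: "M \<ge> 1" using M l by linarith
  have ge: "M * z \<ge> z" if "z \<ge> 0" for z using mult_right_mono[OF M1 that] by simp
  have ld: "l * d \<ge> 0" using l cd by simp
  show False
  proof (cases "b \<le> 0 \<and> a > 0")
    case True
    then have "1 * c \<le> a * c" "b * d \<le> 0"
      using cd by (auto intro!: mult_right_mono simp: mult_nonpos_nonneg)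
    then have "\<bar>a * c - b * d\<bar> \<ge> c" by linarith
    then show False using cnj ge[of "\<bar>a * c - b * d\<bar>"] ld by linarith
  next
    case False
    show False
    proof (cases "a = 0")
      case True
      then have "\<bar>b\<bar> \<ge> 1" using nz by linarith
      then have "real_of_int \<bar>b\<bar> \<ge> 1" by linarith
      then have "1 * w \<le> \<bar>b\<bar> * w" using vw by (intro mult_right_mono) auto
      then have "M * w \<le> M * \<bar>a * v + b * w\<bar>" using M1 True vw by (simp add: abs_mult)
      moreover have "(l + 1) * w \<le> M * w" using M vw by (intro mult_right_mono) auto
      ultimately show False using val vw by (simp add: algebra_simps)
    next
      case False
      then have ab: "a \<ge> 1" "b \<ge> 1" using \<open>\<not> (b \<le> 0 \<and> a > 0)\<close> a by linarith+
      then have "1 * v \<le> a * v" "1 * w \<le> b * w" using vw by (auto intro!: mult_right_mono)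
      then have "v + w \<le> \<bar>a * v + b * w\<bar>" by linarith
      then have "M * (v + w) \<le> M * \<bar>a * v + b * w\<bar>" using M1 by (intro mult_left_mono) auto
      moreover have "(l + 1) * w \<le> M * w" using M vw by (intro mult_right_mono) auto
      moreover have "M * (v + w) = M * v + M * w" "(l + 1) * w = l * w + w" by (simp_all add: algebra_simps)
      ultimately show False using val ge[of v] vw by linarith
    qed
  qed
qed

text \<open>Negating the point changes neither absolute value, so its first coordinate may be taken
  nonnegative.\<close>

lemma box_no_lattice_point:
  fixes l :: int and M :: real
  assumes l: "l \<ge> 0" and M: "M \<ge> l + 1"
    and val: "M * \<bar>val A B\<bar> < V (2 * n) + l * V (Suc (2 * n))"
    and cnj: "M * \<bar>cnj_val A B\<bar> < C (2 * n) + l * C (Suc (2 * n))"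
  shows "A = 0 \<and> B = 0"
proof (rule ccontr)
  assume nz: "\<not> (A = 0 \<and> B = 0)"
  obtain a b where ab: "A = a * N (2 * n) + b * N (Suc (2 * n))" "B = a * D (2 * n) + b * D (Suc (2 * n))"
    by (rule basis)
  from nz ab have ab0: "a \<noteq> 0 \<or> b \<noteq> 0" by auto
  have v: "val A B = a * V (2 * n) + b * V (Suc (2 * n))"
    "cnj_val A B = a * C (2 * n) + b * C (Suc (2 * n))"
    using val_comb cnj_val_comb by (simp_all only: ab)
  show False
  proof (cases "a \<ge> 0")
    case True
    show ?thesis
      by (rule box_no_lattice_point_aux[OF l M ab0 _ _ True, of n]) (use val cnj v in simp_all)
  next
    case False
    have "\<bar>(-a) * V (2 * n) + (-b) * V (Suc (2 * n))\<bar> = \<bar>val A B\<bar>"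
      "\<bar>(-a) * C (2 * n) + (-b) * C (Suc (2 * n))\<bar> = \<bar>cnj_val A B\<bar>"
      unfolding v by linarith+
    then show ?thesis
      by (intro box_no_lattice_point_aux[OF l M, of "-a" "-b" n]) (use val cnj ab0 False in simp_all)
  qed
qed

section \<open>Indecomposable elements as semiconvergents\<close>

text \<open>Euclid-like descent: the coordinates with respect to consecutive convergents decrease until
  the point lies in the cone spanned by two neighbouring totally positive convergents.\<close>

lemma tot_pos_cone_aux:
  assumes "cnj_val A B > 0" "c > 0" "d \<ge> 0"
    "A = c * N (2 * n) + d * N (Suc (2 * n))" "B = c * D (2 * n) + d * D (Suc (2 * n))"
  shows "\<exists>n c d. c > 0 \<and> d \<ge> 0 \<and> d \<le> c * u (Suc (2 * n)) \<and>
    A = c * N (2 * n) + d * N (Suc (2 * n)) \<and> B = c * D (2 * n) + d * D (Suc (2 * n))"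
  using assms(2-)
proof (induction "nat d" arbitrary: n c d rule: less_induct)
  case less
  show ?case
  proof (cases "d \<le> c * u (Suc (2 * n))")
    case True
    then show ?thesis using less.prems by blast
  next
    case False
    \<comment> \<open>The recurrence eliminates first index \<open>2 * n\<close> and then index
      \<open>Suc (2 * n)\<close>; the new coordinates refer to the pair of convergents two places
      further on.\<close>
    define d' where "d' = d - c * u (Suc (2 * n))"
    define c' where "c' = c - u (Suc (Suc (2 * n))) * d'"
    have cu: "c * u (Suc (2 * n)) > 0" using less.prems u_ge_1[of "2 * n"] by simp
    have d': "d' > 0" "nat d' < nat d" using False cu by (auto simp: d'_def)
    have XY: "A = c' * N (2 * Suc n) + d' * N (Suc (2 * Suc n))"
        "B = c' * D (2 * Suc n) + d' * D (Suc (2 * Suc n))"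
      unfolding less.prems c'_def
      by (simp_all add: N_rec D_rec del: cf_num.simps cf_den.simps)
        (simp_all add: d'_def algebra_simps del: cf_num.simps cf_den.simps)
    have "cnj_val A B = c' * C (2 * Suc n) + d' * C (Suc (2 * Suc n))"
      using cnj_val_comb by (simp only: XY)
    moreover have "d' * C (Suc (2 * Suc n)) < 0" using C_odd[of "Suc n"] d' by (intro mult_pos_neg) simp_all
    \<comment> \<open>The odd convergent contributes negatively, so a positive conjugate forces the
      coordinate of the even one to be positive.\<close>
    ultimately have "c' * C (2 * Suc n) > 0" using assms(1) by linarith
    then have "c' > 0" using C_even[of "Suc n"] by (simp add: zero_less_mult_iff)
    show ?thesis
      by (rule less.hyps[OF d'(2) \<open>c' > 0\<close> _ XY]) (use d' in simp)
  qed
qed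

lemma tot_pos_cone:
  assumes "cnj_val A B > 0" "B \<ge> 0"
  obtains n c d where "c > 0" "d \<ge> 0" "d \<le> c * u (Suc (2 * n))"
    "A = c * N (2 * n) + d * N (Suc (2 * n))" "B = c * D (2 * n) + d * D (Suc (2 * n))"
proof -
  have "\<lfloor>\<xi>\<rfloor> * real_of_int B \<le> \<xi> * B" using assms by (intro mult_right_mono) auto
  then have "real_of_int (A - \<lfloor>\<xi>\<rfloor> * B) > 0" using assms by (simp add: cnj_val_def mult.commute)
  then have "A - \<lfloor>\<xi>\<rfloor> * B > 0" by (simp only: of_int_0_less_iff)
  \<comment> \<open>The descent starts at \<open>n = 0\<close>: indices 0 and 1 stand for 1 and
    (floor of \<xi>) + \<omega>, so the second coordinate is \<open>B\<close> itself.\<close>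
  from tot_pos_cone_aux[OF assms(1) this assms(2), of 0] that show ?thesis by auto
qed

text \<open>The conjugate decreases as \<open>d\<close> grows, and at the upper end
  \<open>d = c * u (Suc (2 * n))\<close> it is still \<open>c\<close> times the conjugate of the
  next even convergent.\<close>

lemma cone_tot_pos:
  assumes "c > 0" "d \<ge> 0" "d \<le> c * u (Suc (2 * n))"
  shows "tot_pos (c * N (2 * n) + d * N (Suc (2 * n))) (c * D (2 * n) + d * D (Suc (2 * n)))"
  unfolding tot_pos_def val_comb cnj_val_comb
proof
  show "0 < c * V (2 * n) + d * V (Suc (2 * n))"
    using assms V_pos[of "2 * n"] V_pos[of "Suc (2 * n)"] by (simp add: add_pos_nonneg)
  have "0 < c * C (Suc (Suc (2 * n)))" using C_even[of "Suc n"] assms by simp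
  also have "\<dots> = c * C (2 * n) + (c * u (Suc (2 * n))) * C (Suc (2 * n))"
    by (simp add: C_rec algebra_simps)
  also have "\<dots> \<le> c * C (2 * n) + d * C (Suc (2 * n))"
    using C_odd[of n] assms(3)
    by (intro add_left_mono mult_right_mono_neg) (simp_all flip: of_int_mult)
  finally show "0 < c * C (2 * n) + d * C (Suc (2 * n))" .
qed

text \<open>A point whose first coordinate \<open>c\<close> exceeds 1 splits into two points of the
  same cone, so indecomposability forces \<open>c = 1\<close>.\<close>

lemma indecomposable_semiconvergent:
  assumes indec: "lattice_indecomposable A B" and "B \<ge> 0"
  obtains n l where "l \<ge> 0" "l \<le> u (Suc (2 * n))"
    "A = N (2 * n) + l * N (Suc (2 * n))" "B = D (2 * n) + l * D (Suc (2 * n))"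
proof -
  have cnj: "cnj_val A B > 0" using indec by (simp add: lattice_indecomposable_def tot_pos_def)
  obtain n c d where cd: "c > 0" "d \<ge> 0" "d \<le> c * u (Suc (2 * n))"
    "A = c * N (2 * n) + d * N (Suc (2 * n))" "B = c * D (2 * n) + d * D (Suc (2 * n))"
    by (rule tot_pos_cone[OF cnj assms(2)])
  have "c = 1"
  proof (rule ccontr)
    assume "c \<noteq> 1"
    then have c: "c - 1 > 0" using cd by simp
    \<comment> \<open>The slope is rounded down so that both \<open>(1, l)\<close> and
      \<open>(c - 1, d - l)\<close> satisfy the cone inequalities.\<close>
    define l where "l = d div c"
    have l0: "l \<ge> 0" using cd by (simp add: l_def pos_imp_zdiv_nonneg_iff)
    have d_eq: "d = l * c + d mod c" by (simp add: l_def)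
    have rem: "0 \<le> d mod c" "d mod c < c" using cd by auto
    have lu: "l \<le> u (Suc (2 * n))"
      using zdiv_mono1[OF cd(3) cd(1)] cd(1) by (simp add: l_def)
    have "l * (c - 1) \<ge> 0" using l0 c by (intro mult_nonneg_nonneg) auto
    then have "d - l \<ge> 0" using rem d_eq by (simp add: algebra_simps)
    moreover have "d - l \<le> (c - 1) * u (Suc (2 * n))"
    \<comment> \<open>Rounding gives \<open>d - l <= (c - 1) * (l + 1)\<close>, which suffices as
      long as \<open>l + 1\<close> is at most the partial quotient; at equality the cone bound on
      \<open>d\<close> is used directly.\<close>
    proof (cases "l = u (Suc (2 * n))")
      case True
      then show ?thesis using cd(3) by (simp add: algebra_simps)
    next
      case False
      then have "l + 1 \<le> u (Suc (2 * n))" using lu by simp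
      then have "(c - 1) * (l + 1) \<le> (c - 1) * u (Suc (2 * n))" using c by simp
      moreover have "d - l \<le> (c - 1) * (l + 1)" using d_eq rem by (simp add: algebra_simps)
      ultimately show ?thesis by linarith
    qed
    ultimately have 1: "tot_pos ((c-1) * N (2 * n) + (d-l) * N (Suc (2 * n))) ((c-1) * D (2 * n) + (d-l) * D (Suc (2 * n)))"
      using c by (intro cone_tot_pos)
    have 2: "tot_pos (1 * N (2 * n) + l * N (Suc (2 * n))) (1 * D (2 * n) + l * D (Suc (2 * n)))"
      using l0 lu by (intro cone_tot_pos) simp_all
    have 3: "A = ((c-1) * N (2 * n) + (d-l) * N (Suc (2 * n))) + (1 * N (2 * n) + l * N (Suc (2 * n)))"
      "B = ((c-1) * D (2 * n) + (d-l) * D (Suc (2 * n))) + (1 * D (2 * n) + l * D (Suc (2 * n)))"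
      unfolding cd by (simp_all add: algebra_simps del: cf_num.simps cf_den.simps)
    show False
      using indec 1 2 3 unfolding lattice_indecomposable_def by blast
  qed
  then show ?thesis using that[of d n] cd by simp
qed

lemma indecomposable_box_nonneg:
  fixes M :: real
  assumes indec: "lattice_indecomposable A B" and "B \<ge> 0"
    and M: "\<And>i. odd i \<Longrightarrow> u i \<le> M"
    and less: "M * \<bar>val A' B'\<bar> < val A B" "M * \<bar>cnj_val A' B'\<bar> < cnj_val A B"
  shows "A' = 0 \<and> B' = 0"
proof -
  obtain n l where l: "l \<ge> 0" "l \<le> u (Suc (2 * n))"
    "A = N (2 * n) + l * N (Suc (2 * n))" "B = D (2 * n) + l * D (Suc (2 * n))"
    using indecomposable_semiconvergent[OF assms(1,2)] by metis
  have v: "val A B = V (2 * n) + l * V (Suc (2 * n))"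
    "cnj_val A B = C (2 * n) + l * C (Suc (2 * n))"
    using val_comb[of 1 "2 * n" l "Suc (2 * n)"] cnj_val_comb[of 1 "2 * n" l "Suc (2 * n)"]
    by (simp_all add: l)
  have uM: "u (Suc (2 * n)) \<le> M" by (rule M) simp
  show ?thesis
  proof (cases "l = u (Suc (2 * n))")
    case False
    then have "l + 1 \<le> M" using l uM by linarith
    then show ?thesis
      using box_no_lattice_point[OF l(1), of M A' B' n] less v by simp
  next
    case True
    \<comment> \<open>At the upper end the point is the next even convergent. Viewed from there it
      has \<open>l = 0\<close>, which asks only for \<open>M >= 1\<close>; the old basis would ask
      for one more than the partial quotient.\<close>
    have "M \<ge> 1" using uM u_ge_1[of "2 * n"] by linarith
    then show ?thesis
      using box_no_lattice_point[of 0 M A' B' "Suc n"] less v True by (simp add: V_rec C_rec add.commute)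
  qed
qed

section \<open>Conjugation symmetry\<close>

lemma val_flip: "val (A + B * t) (- B) = cnj_val A B"
  and cnj_val_flip: "cnj_val (A + B * t) (- B) = val A B"
  by (simp_all add: val_def cnj_val_def trace[symmetric] algebra_simps)

lemma tot_pos_flip: "tot_pos (A + B * t) (- B) \<longleftrightarrow> tot_pos A B"
  by (auto simp: tot_pos_def val_flip cnj_val_flip)

text \<open>Conjugation is additive and exchanges the two embeddings, so it carries decompositions
  to decompositions. It reduces negative \<open>B\<close> to the case already treated.\<close>

lemma lattice_indecomposable_flip:
  assumes "lattice_indecomposable A B"
  shows "lattice_indecomposable (A + B * t) (- B)"
  unfolding lattice_indecomposable_def
proof (intro conjI notI)
  show "tot_pos (A + B * t) (- B)"
    using assms by (simp add: lattice_indecomposable_def tot_pos_flip)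
  assume "\<exists>A1 B1 A2 B2. tot_pos A1 B1 \<and> tot_pos A2 B2 \<and> A + B * t = A1 + A2 \<and> - B = B1 + B2"
  then obtain A1 B1 A2 B2 where *: "tot_pos A1 B1" "tot_pos A2 B2" "A + B * t = A1 + A2" "- B = B1 + B2"
    by blast
  then have **: "tot_pos (A1 + B1 * t) (- B1)" "tot_pos (A2 + B2 * t) (- B2)" "B = - B1 + - B2"
    by (simp_all add: tot_pos_flip)
  have "A = A1 + A2 - B * t" using *(3) by simp
  then have "A = (A1 + B1 * t) + (A2 + B2 * t)"
    unfolding **(3) by (simp add: algebra_simps)
  with ** assms show False unfolding lattice_indecomposable_def by blast
qed

lemma indecomposable_box:
  fixes M :: real
  assumes indec: "lattice_indecomposable A B"
    and M: "\<And>i. odd i \<Longrightarrow> u i \<le> M"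
    and less: "M * \<bar>val A' B'\<bar> < val A B" "M * \<bar>cnj_val A' B'\<bar> < cnj_val A B"
  shows "A' = 0 \<and> B' = 0"
proof (cases "B \<ge> 0")
  case True
  then show ?thesis using indecomposable_box_nonneg[OF indec _ M] less by blast
next
  case False
  have "A' + B' * t = 0 \<and> - B' = 0"
    by (rule indecomposable_box_nonneg[OF lattice_indecomposable_flip[OF indec] _ M])
       (use False less in \<open>simp_all add: val_flip cnj_val_flip\<close>)
  then show ?thesis by auto
qed

text \<open>A positive conjugate forces an even index; then the box lemma applies with
  \<open>l = 0\<close> and factor 1, so no partial quotient enters.\<close>

lemma convergent_box:
  assumes "cnj_val (N j) (D j) > 0"
    and less: "\<bar>val A' B'\<bar> < val (N j) (D j)" "\<bar>cnj_val A' B'\<bar> < cnj_val (N j) (D j)"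
  shows "A' = 0 \<and> B' = 0"
proof -
  have "even j" using assms(1) C_sign[of j] by (cases "even j") (auto simp: C_def)
  then obtain n where "j = 2 * n" by blast
  then show ?thesis
    using box_no_lattice_point[of 0 1 A' B' n] less by (simp add: V_def C_def)
qed

section \<open>Boundedness of the partial quotients\<close>

lemma norm_ge_1:
  assumes "val A B \<noteq> 0" "cnj_val A B \<noteq> 0"
  shows "\<bar>val A B\<bar> * \<bar>cnj_val A B\<bar> \<ge> 1"
proof -
  have "val A B * cnj_val A B = A\<^sup>2 + A * B * (\<omega> - \<xi>) - B\<^sup>2 * (\<omega> * \<xi>)"
    by (simp add: val_def cnj_val_def algebra_simps power2_eq_square)
  also have "\<dots> = of_int (A\<^sup>2 + A * B * t - B\<^sup>2 * s)" by (simp add: trace norm)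
  finally have eq: "val A B * cnj_val A B = of_int (A\<^sup>2 + A * B * t - B\<^sup>2 * s)" .
  with assms have "A\<^sup>2 + A * B * t - B\<^sup>2 * s \<noteq> 0" by fastforce
  then have "\<bar>A\<^sup>2 + A * B * t - B\<^sup>2 * s\<bar> \<ge> 1" by linarith
  then have "\<bar>val A B * cnj_val A B\<bar> \<ge> 1" unfolding eq by linarith
  then show ?thesis by (simp add: abs_mult)
qed

text \<open>With \<open>i = Suc j\<close>, the determinant and the alternating signs give
  \<open>D (Suc i) * |C i| <= 1\<close>, while the norm gives \<open>1 <= V i * |C i|\<close>. So
  \<open>u i * D i <= D (Suc i) <= V i\<close>, and \<open>V i\<close> is at most
  \<open>\<xi> + 1 + \<omega>\<close> times \<open>D i\<close>.\<close>

lemma partial_quotient_bounded: "u (Suc j) \<le> \<xi> + 1 + \<omega>"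
proof -
  let ?i = "Suc j"
  \<comment> \<open>\<open>e\<close> is the sign of \<open>C (Suc j)\<close>; multiplying by it
    produces the absolute value.\<close>
  define e :: int where "e = (-1) ^ ?i"
  have e: "e * e = 1" "real_of_int e = (-1) ^ ?i" by (simp_all add: e_def flip: power_add)
  have c1: "e * C ?i > 0" using C_sign[of ?i] by (simp add: e)
  have c2: "e * C (Suc ?i) < 0" using C_sign[of "Suc ?i"] by (simp add: e)
  have "D (Suc ?i) * (e * C ?i) - D ?i * (e * C (Suc ?i)) = e * (D (Suc ?i) * N ?i - D ?i * N (Suc ?i))"
    by (simp add: C_def cnj_val_def algebra_simps del: cf_num.simps cf_den.simps)
  also have "\<dots> = of_int (e * - (N (Suc ?i) * D ?i - N ?i * D (Suc ?i)))" by (simp add: mult.commute del: cf_num.simps cf_den.simps)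
  also have "\<dots> = of_int (e * e)" unfolding cf_det e_def by simp
  finally have sum: "D (Suc ?i) * (e * C ?i) - D ?i * (e * C (Suc ?i)) = 1" by (simp add: e)
  have "D ?i * (e * C (Suc ?i)) \<le> 0" using c2 D_pos[of j] by (simp add: mult_nonneg_nonpos)
  with sum have DC: "D (Suc ?i) * (e * C ?i) \<le> 1" by linarith
  have eC: "e * C ?i = \<bar>C ?i\<bar>"
  proof -
    have "e = 1 \<or> e = -1" unfolding e_def by (cases "even ?i") simp_all
    with c1 show ?thesis by auto
  qed
  have "C ?i \<noteq> 0" using c1 by auto
  then have "V ?i * \<bar>C ?i\<bar> \<ge> 1" using norm_ge_1[of "N ?i" "D ?i"] V_pos[of ?i] by (simp add: V_def C_def)
  with DC eC have "D (Suc ?i) * \<bar>C ?i\<bar> \<le> V ?i * \<bar>C ?i\<bar>" by simp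
  then have DV: "D (Suc ?i) \<le> V ?i" using \<open>C ?i \<noteq> 0\<close> by (simp add: mult_le_cancel_right)
  have "u ?i * D ?i \<le> D (Suc ?i)" using D_nonneg[of j] by (simp only: D_rec)
  then have uD: "real_of_int (u ?i) * D ?i \<le> D (Suc ?i)" by (metis of_int_le_iff of_int_mult)
  have DC1: "real_of_int (D ?i) \<ge> 1" using D_pos[of j] by linarith
  have "real_of_int (D (Suc ?i)) \<ge> 1" using D_pos[of ?i] by linarith
  then have "1 * \<bar>C ?i\<bar> \<le> D (Suc ?i) * \<bar>C ?i\<bar>" by (intro mult_right_mono) auto
  then have "\<bar>C ?i\<bar> \<le> D ?i" using DC[unfolded eC] DC1 by linarith
  then have "N ?i \<le> D ?i * \<xi> + D ?i" by (simp add: C_def cnj_val_def)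
  then have "V ?i \<le> (\<xi> + 1 + \<omega>) * D ?i" by (simp add: V_def val_def algebra_simps)
  with uD DV have "real_of_int (u ?i) * D ?i \<le> (\<xi> + 1 + \<omega>) * D ?i" by linarith
  then show ?thesis using D_pos[of j] by (simp add: mult_le_cancel_right)
qed

lemma val_inj:
  assumes "val A B = val A' B'"
  shows "A = A' \<and> B = B'"
proof -
  have "\<omega> \<notin> \<rat>"
  proof
    assume "\<omega> \<in> \<rat>"
    then have "\<omega> - of_int t \<in> \<rat>" by simp
    then show False using irrational by (simp flip: trace)
  qed
  moreover have "\<omega> = of_int (A' - A) / of_int (B - B')" if "B \<noteq> B'"
    using assms that by (simp add: val_def field_simps)
  ultimately have "B = B'" by (metis Rats_divide Rats_of_int)
  then show ?thesis using assms by (simp add: val_def)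
qed

text \<open>\<open>Max\<close> is informative only on a finite set; boundedness supplies finiteness
  without an appeal to periodicity.\<close>

lemma finite_odd_partial_quotients: "finite {u i | i. odd i}"
proof (rule finite_subset)
  show "{u i | i. odd i} \<subseteq> {1..\<lfloor>\<xi> + 1 + \<omega>\<rfloor>}"
    using u_ge_1 partial_quotient_bounded
    by (auto simp: le_floor_iff elim!: oddE)
qed simp

lemma odd_partial_quotient_le_Max: "odd i \<Longrightarrow> u i \<le> Max {u i | i. odd i}"
  using finite_odd_partial_quotients by (intro Max_ge) auto

end

section \<open>Subfields of the reals and their embeddings\<close>

lemma ring_of_type_algebra_simps [simp]:
  "carrier (ring_of_type_algebra :: 'a :: comm_ring_1 ring) = UNIV"
  "x \<otimes>\<^bsub>(ring_of_type_algebra :: 'a :: comm_ring_1 ring)\<^esub> y = x * y"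
  "x \<oplus>\<^bsub>(ring_of_type_algebra :: 'a :: comm_ring_1 ring)\<^esub> y = x + y"
  "\<one>\<^bsub>(ring_of_type_algebra :: 'a :: comm_ring_1 ring)\<^esub> = 1"
  "\<zero>\<^bsub>(ring_of_type_algebra :: 'a :: comm_ring_1 ring)\<^esub> = 0"
  by (simp_all add: ring_of_type_algebra_def)

lemma real_ring_a_inv: "\<ominus>\<^bsub>real_ring\<^esub> x = - x"
proof -
  interpret ring real_ring by (rule ring_from_type_algebra)
  show ?thesis by (rule minus_equality) simp_all
qed

lemma real_ring_m_inv: "x \<noteq> 0 \<Longrightarrow> inv\<^bsub>real_ring\<^esub> x = inverse x"
  using comm_monoid.comm_inv_char[OF cring.axioms(2)[OF cring_from_type_algebra], of x "inverse x"]
  by simp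

text \<open>Closure under \<open>inverse\<close> can be demanded of every element, as
  \<open>inverse 0 = 0\<close>.\<close>

definition real_subfield :: "real set \<Rightarrow> bool" where
  "real_subfield F \<longleftrightarrow> 1 \<in> F \<and> (\<forall>x\<in>F. \<forall>y\<in>F. x - y \<in> F \<and> x * y \<in> F) \<and> (\<forall>x\<in>F. inverse x \<in> F)"

lemma real_subfieldD:
  assumes "real_subfield F"
  shows "1 \<in> F" "0 \<in> F" "x \<in> F \<Longrightarrow> - x \<in> F" "x \<in> F \<Longrightarrow> y \<in> F \<Longrightarrow> x + y \<in> F"
    "x \<in> F \<Longrightarrow> y \<in> F \<Longrightarrow> x - y \<in> F" "x \<in> F \<Longrightarrow> y \<in> F \<Longrightarrow> x * y \<in> F"
    "x \<in> F \<Longrightarrow> inverse x \<in> F" "x \<in> F \<Longrightarrow> y \<in> F \<Longrightarrow> x / y \<in> F"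
proof -
  show 1: "1 \<in> F" and m: "x \<in> F \<Longrightarrow> y \<in> F \<Longrightarrow> x - y \<in> F" "x \<in> F \<Longrightarrow> y \<in> F \<Longrightarrow> x * y \<in> F"
    and i: "x \<in> F \<Longrightarrow> inverse x \<in> F" for x y
    using assms by (auto simp: real_subfield_def)
  show 0: "0 \<in> F" using m(1)[OF 1 1] by simp
  show u: "x \<in> F \<Longrightarrow> - x \<in> F" for x using m(1)[OF 0] by simp
  show "x \<in> F \<Longrightarrow> y \<in> F \<Longrightarrow> x + y \<in> F" using m(1)[of x "- y"] u by simp
  show "x \<in> F \<Longrightarrow> y \<in> F \<Longrightarrow> x / y \<in> F" using m(2)[of x "inverse y"] i by (simp add: divide_inverse)
qed

lemma real_subfield_Rats: "real_subfield \<rat>"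
  by (simp add: real_subfield_def)

lemma Rats_subset_real_subfield:
  assumes F: "real_subfield F" shows "\<rat> \<subseteq> F"
proof
  fix x :: real assume "x \<in> \<rat>"
  then obtain a b :: int where x: "x = of_int a / of_int b" by (elim Rats_cases') auto
  have nat: "of_nat n \<in> F" for n
    by (induction n) (use real_subfieldD[OF F] in auto)
  have "of_int c \<in> F" for c :: int
    by (cases c rule: int_diff_cases) (use nat real_subfieldD(5)[OF F] in auto)
  then show "x \<in> F" using x real_subfieldD(8)[OF F] by simp
qed

lemma rat_adjoin_subset:
  assumes F: "real_subfield F" and "S \<subseteq> F"
  shows "rat_adjoin S \<subseteq> F"
proof
  fix x assume "x \<in> rat_adjoin S"
  then show "x \<in> F" unfolding rat_adjoin_def
    by (induction rule: generate_field.induct)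
       (use real_subfieldD[OF F] assms(2) in \<open>auto simp: real_ring_a_inv real_ring_m_inv\<close>)
qed

lemma real_subfield_rat_adjoin: "real_subfield (rat_adjoin S)"
proof -
  let ?F = "generate_field real_ring S"
  have 1: "1 \<in> ?F" using generate_field.one[of real_ring S] by simp
  have u: "- x \<in> ?F" if "x \<in> ?F" for x
    using generate_field.a_inv[OF that] by (simp add: real_ring_a_inv)
  have a: "x + y \<in> ?F" if "x \<in> ?F" "y \<in> ?F" for x y
    using generate_field.eng_add[OF that] by simp
  have m: "x * y \<in> ?F" if "x \<in> ?F" "y \<in> ?F" for x y
    using generate_field.eng_mult[OF that] by simp
  have i: "inverse x \<in> ?F" if "x \<in> ?F" for x
    using generate_field.m_inv[OF that] that by (cases "x = 0") (auto simp: real_ring_m_inv)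
  have "x - y \<in> ?F" if "x \<in> ?F" "y \<in> ?F" for x y
    using a[OF that(1) u[OF that(2)]] by simp
  with 1 m i show ?thesis unfolding real_subfield_def rat_adjoin_def by blast
qed

lemma rat_adjoin_incl: "S \<subseteq> rat_adjoin S"
  unfolding rat_adjoin_def by (auto intro: generate_field.incl)

section \<open>Adjoining a square root\<close>

definition adj :: "real set \<Rightarrow> real \<Rightarrow> real set" where
  "adj F s = {a + b * s | a b. a \<in> F \<and> b \<in> F}"

lemma adjI: "a \<in> F \<Longrightarrow> b \<in> F \<Longrightarrow> a + b * s \<in> adj F s"
  by (auto simp: adj_def)

lemma adj_contains:
  assumes "real_subfield F"
  shows "F \<subseteq> adj F s" "s \<in> adj F s"
  using adjI[of _ F 0 s] adjI[of 0 F 1 s] real_subfieldD[OF assms] by auto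

text \<open>Inverses come from the conjugate \<open>a - b * s\<close>, whose product with
  \<open>a + b * s\<close> lies in \<open>F\<close>.\<close>

lemma real_subfield_adj:
  assumes F: "real_subfield F" and s: "s * s \<in> F"
  shows "real_subfield (adj F s)"
proof -
  note f = real_subfieldD[OF F]
  have minus: "x - y \<in> adj F s" if "x \<in> adj F s" "y \<in> adj F s" for x y
  proof -
    from that obtain a b c d where *: "x = a + b * s" "y = c + d * s" "a \<in> F" "b \<in> F" "c \<in> F" "d \<in> F"
      by (auto simp: adj_def)
    then have "x - y = (a - c) + (b - d) * s" by (simp add: algebra_simps)
    then show ?thesis using * f by (metis adjI)
  qed
  have mult: "x * y \<in> adj F s" if "x \<in> adj F s" "y \<in> adj F s" for x y
  proof -
    from that obtain a b c d where *: "x = a + b * s" "y = c + d * s" "a \<in> F" "b \<in> F" "c \<in> F" "d \<in> F"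
      by (auto simp: adj_def)
    then have "x * y = (a * c + b * d * (s * s)) + (a * d + b * c) * s" by (simp add: algebra_simps)
    moreover have "a * c + b * d * (s * s) \<in> F" "a * d + b * c \<in> F" using * s f by auto
    ultimately show ?thesis by (metis adjI)
  qed
  have inverse: "inverse x \<in> adj F s" if "x \<in> adj F s" for x
  proof -
    from that obtain a b where *: "x = a + b * s" "a \<in> F" "b \<in> F"
      by (auto simp: adj_def)
    define y where "y = a + (- b) * s"
    have y: "y \<in> adj F s" unfolding y_def using * f by (intro adjI) auto
    have "x * y = a * a - b * b * (s * s)" by (simp add: * y_def algebra_simps)
    then have xy: "x * y \<in> F" using * s f by simp
    show ?thesis
    proof (cases "y = 0")
      case True
      \<comment> \<open>If the conjugate vanishes, then \<open>b * s = a\<close> and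
        \<open>x\<close> already lies in \<open>F\<close>.\<close>
      then have "x = 2 * a" using * by (simp add: y_def)
      then have "x \<in> F" using * f(4)[of a a] by simp
      then show ?thesis using f(7) adj_contains(1)[OF F] by blast
    next
      case False
      then have "inverse x = y * inverse (x * y)" by (simp add: field_simps)
      moreover have "inverse (x * y) \<in> adj F s" using xy f(7) adj_contains(1)[OF F] by blast
      ultimately show ?thesis using mult[OF y] by metis
    qed
  qed
  show ?thesis
    unfolding real_subfield_def using minus mult inverse f(1) adj_contains(1)[OF F] by blast
qed

lemma adj_minimal:
  assumes "real_subfield E" "F \<subseteq> E" "s \<in> E"
  shows "adj F s \<subseteq> E"
  using real_subfieldD[OF assms(1)] assms(2,3) by (auto simp: adj_def subset_iff)

lemma sqrt_mult_self_Rats: "sqrt (real k) * sqrt (real k) \<in> \<rat>"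
  by simp

lemma rat_adjoin_sqrt: "rat_adjoin {sqrt (real k)} = adj \<rat> (sqrt (real k))"
proof
  show "rat_adjoin {sqrt (real k)} \<subseteq> adj \<rat> (sqrt (real k))"
    by (intro rat_adjoin_subset real_subfield_adj real_subfield_Rats)
       (auto simp: adj_contains real_subfield_Rats)
  show "adj \<rat> (sqrt (real k)) \<subseteq> rat_adjoin {sqrt (real k)}"
    using rat_adjoin_incl
    by (intro adj_minimal real_subfield_rat_adjoin Rats_subset_real_subfield) auto
qed

lemma rat_adjoin_sqrt2:
  "rat_adjoin {sqrt (real p), sqrt (real q)} = adj (adj \<rat> (sqrt (real p))) (sqrt (real q))"
proof
  have 1: "real_subfield (adj \<rat> (sqrt (real p)))"
    by (intro real_subfield_adj real_subfield_Rats) auto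
  have 2: "sqrt (real q) * sqrt (real q) \<in> adj \<rat> (sqrt (real p))"
    using adj_contains(1)[OF real_subfield_Rats, of "sqrt (real p)"] sqrt_mult_self_Rats[of q] by blast
  show "rat_adjoin {sqrt (real p), sqrt (real q)} \<subseteq> adj (adj \<rat> (sqrt (real p))) (sqrt (real q))"
    using adj_contains[OF 1, of "sqrt (real q)"] adj_contains(2)[OF real_subfield_Rats, of "sqrt (real p)"]
    by (intro rat_adjoin_subset real_subfield_adj 1 2) auto
  show "adj (adj \<rat> (sqrt (real p))) (sqrt (real q)) \<subseteq> rat_adjoin {sqrt (real p), sqrt (real q)}"
    using rat_adjoin_incl[of "{sqrt (real p), sqrt (real q)}"]
    by (intro adj_minimal real_subfield_rat_adjoin Rats_subset_real_subfield) auto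
qed

section \<open>Homomorphisms into the reals and their extensions\<close>

definition real_hom :: "real set \<Rightarrow> (real \<Rightarrow> real) \<Rightarrow> bool" where
  "real_hom F \<sigma> \<longleftrightarrow> \<sigma> 1 = 1 \<and> (\<forall>x\<in>F. \<forall>y\<in>F. \<sigma> (x + y) = \<sigma> x + \<sigma> y \<and> \<sigma> (x * y) = \<sigma> x * \<sigma> y)"

text \<open>The extension may send \<open>s\<close> to either real square root of the image of
  \<open>s * s\<close>; varying the sign of \<open>t\<close> produces the conjugates.\<close>

lemma real_hom_extend:
  assumes F: "real_subfield F" and ss: "s * s \<in> F" and s: "s \<notin> F"
    and hom: "real_hom F \<sigma>" and t: "t * t = \<sigma> (s * s)"
  obtains \<tau> where "real_hom (adj F s) \<tau>" "\<And>a b. a \<in> F \<Longrightarrow> b \<in> F \<Longrightarrow> \<tau> (a + b * s) = \<sigma> a + \<sigma> b * t"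
proof -
  note f = real_subfieldD[OF F]
  have uniq: "a = c \<and> b = d" if "a + b * s = c + d * s" "a \<in> F" "b \<in> F" "c \<in> F" "d \<in> F" for a b c d
  proof -
    have "b = d"
    proof (rule ccontr)
      assume "b \<noteq> d"
      then have "s = (c - a) / (b - d)" using that(1) by (simp add: field_simps)
      then show False using s f(8)[OF f(5)[OF that(4,2)] f(5)[OF that(3,5)]] by simp
    qed
    then show ?thesis using that by simp
  qed
  \<comment> \<open>The value is read off from some representation of \<open>x\<close>; it is well
    defined because \<open>s\<close> outside \<open>F\<close> makes representations unique.\<close>
  define \<tau> where "\<tau> x = (SOME y. \<exists>a\<in>F. \<exists>b\<in>F. x = a + b * s \<and> y = \<sigma> a + \<sigma> b * t)" for x
  have \<tau>: "\<tau> (a + b * s) = \<sigma> a + \<sigma> b * t" if "a \<in> F" "b \<in> F" for a b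
    unfolding \<tau>_def by (rule some_equality) (use that uniq in blast)+
  have h: "\<sigma> 1 = 1" "\<And>x y. x \<in> F \<Longrightarrow> y \<in> F \<Longrightarrow> \<sigma> (x + y) = \<sigma> x + \<sigma> y"
    "\<And>x y. x \<in> F \<Longrightarrow> y \<in> F \<Longrightarrow> \<sigma> (x * y) = \<sigma> x * \<sigma> y"
    using hom by (auto simp: real_hom_def)
  have "\<sigma> 0 = 0" using h(2)[OF f(2,2)] by simp
  then have "\<tau> 1 = 1" using \<tau>[OF f(1,2)] h(1) by simp
  moreover have "\<tau> (x + y) = \<tau> x + \<tau> y \<and> \<tau> (x * y) = \<tau> x * \<tau> y" if xy: "x \<in> adj F s" "y \<in> adj F s" for x y
  proof -
    from xy obtain a b c d where *: "x = a + b * s" "y = c + d * s" and m: "a \<in> F" "b \<in> F" "c \<in> F" "d \<in> F"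
      by (auto simp: adj_def)
    have "x + y = (a + c) + (b + d) * s" by (simp add: * algebra_simps)
    then have "\<tau> (x + y) = \<sigma> (a + c) + \<sigma> (b + d) * t" using \<tau>[OF f(4) f(4)] m by simp
    then have 1: "\<tau> (x + y) = \<tau> x + \<tau> y" using m by (simp add: h * \<tau> algebra_simps)
    have "x * y = (a * c + b * d * (s * s)) + (a * d + b * c) * s" by (simp add: * algebra_simps)
    then have "\<tau> (x * y) = \<sigma> (a * c + b * d * (s * s)) + \<sigma> (a * d + b * c) * t"
      using \<tau>[of "a * c + b * d * (s * s)" "a * d + b * c"] m f ss by simp
    also have "\<dots> = \<sigma> a * \<sigma> c + \<sigma> b * \<sigma> d * (t * t) + (\<sigma> a * \<sigma> d + \<sigma> b * \<sigma> c) * t"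
      using m f ss t by (simp add: h)
    finally have "\<tau> (x * y) = \<tau> x * \<tau> y" using m by (simp add: * \<tau> algebra_simps)
    with 1 show ?thesis by simp
  qed
  ultimately have "real_hom (adj F s) \<tau>" by (simp add: real_hom_def)
  then show ?thesis using \<tau> that by blast
qed

text \<open>A homomorphism fixing the rationals commutes with integer polynomials, so the image is a
  root of the same monic polynomial.\<close>

lemma real_hom_algebraic_int:
  assumes F: "real_subfield F" and hom: "real_hom F \<sigma>" and Rats: "\<And>x. x \<in> \<rat> \<Longrightarrow> \<sigma> x = x"
    and x: "x \<in> F" "algebraic_int x"
  shows "algebraic_int (\<sigma> x)"
proof -
  note f = real_subfieldD[OF F]
  obtain p :: "int poly" where p: "poly (map_poly of_int p) x = 0" "lead_coeff p = 1"
    using x(2) unfolding algebraic_int_altdef_ipoly by blast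
  have "poly (map_poly of_int p) x \<in> F \<and> \<sigma> (poly (map_poly of_int p) x) = poly (map_poly of_int p) (\<sigma> x)" for p :: "int poly"
  proof (induction p)
    case 0
    then show ?case using f(2) Rats[of 0] by simp
  next
    case (pCons a p)
    have "real_of_int a \<in> F" using Rats_subset_real_subfield[OF F] Rats_of_int by blast
    then show ?case using pCons f x hom Rats[of "of_int a"]
      by (simp add: map_poly_pCons real_hom_def)
  qed
  from this[of p] p show ?thesis
    unfolding algebraic_int_altdef_ipoly using Rats[of 0] by auto
qed

section \<open>Embeddings and total positivity\<close>

lemma real_hom_embedding:
  assumes "real_hom F \<sigma>"
  shows "(\<lambda>x. complex_of_real (\<sigma> x)) \<in> embeddings F"
  unfolding embeddings_def
  by (rule ring_hom_memI) (use assms in \<open>auto simp: real_hom_def\<close>)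

lemma embeddingsD:
  assumes "\<sigma> \<in> embeddings F"
  shows "\<sigma> 1 = 1" "x \<in> F \<Longrightarrow> y \<in> F \<Longrightarrow> \<sigma> (x + y) = \<sigma> x + \<sigma> y"
    "x \<in> F \<Longrightarrow> y \<in> F \<Longrightarrow> \<sigma> (x * y) = \<sigma> x * \<sigma> y"
  using ring_hom_one[of \<sigma> "real_ring\<lparr>carrier := F\<rparr>" complex_ring]
    ring_hom_add[of \<sigma> "real_ring\<lparr>carrier := F\<rparr>" complex_ring x y]
    ring_hom_mult[of \<sigma> "real_ring\<lparr>carrier := F\<rparr>" complex_ring x y]
    assms unfolding embeddings_def by auto

lemma embeddings_mono:
  assumes "E \<subseteq> F" "\<sigma> \<in> embeddings F" shows "\<sigma> \<in> embeddings E"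
  unfolding embeddings_def
  by (rule ring_hom_memI) (use assms embeddingsD[OF assms(2)] in \<open>auto simp: subset_iff\<close>)

text \<open>Every embedding of \<open>F\<close> is also one of \<open>E\<close>, so positivity under
  all embeddings of \<open>E\<close> covers those of \<open>F\<close>.\<close>

lemma pos_integers_of_mono:
  assumes "E \<subseteq> F" "x \<in> pos_integers_of E" shows "x \<in> pos_integers_of F"
  using assms embeddings_mono[OF assms(1)] by (auto simp: pos_integers_of_def integers_of_def)

lemma embedding_Rats:
  assumes F: "real_subfield F" and \<sigma>: "\<sigma> \<in> embeddings F" and x: "x \<in> \<rat>"
  shows "\<sigma> x = of_real x"
proof -
  note f = real_subfieldD[OF F] and h = embeddingsD[OF \<sigma>]
  have R: "y \<in> F" if "y \<in> \<rat>" for y using Rats_subset_real_subfield[OF F] that by blast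
  have z: "\<sigma> 0 = 0" using h(2)[OF f(2,2)] by simp
  have nat: "\<sigma> (of_nat n) = of_nat n" for n
    by (induction n) (simp_all add: z h R f(1))
  have int: "\<sigma> (of_int c) = of_int c" for c :: int
  proof (cases c rule: int_diff_cases)
    case (diff m n)
    have "\<sigma> (real_of_int c + real n) = \<sigma> (of_int c) + \<sigma> (real n)" by (rule h(2)) (auto intro: R)
    then show ?thesis using nat[of m] nat[of n] by (simp add: diff)
  qed
  obtain a b :: int where ab: "b > 0" "x = of_int a / of_int b" using x by (elim Rats_cases') auto
  have "\<sigma> (x * of_int b) = \<sigma> x * \<sigma> (of_int b)" using x by (intro h(3) R) auto
  then have "\<sigma> x * of_int b = of_int a" using ab int by simp
  then have "\<sigma> x = of_int a / of_int b" using ab(1) by (simp add: eq_divide_eq)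
  then show ?thesis by (simp add: ab(2))
qed

section \<open>Real quadratic fields\<close>

lemma sqrt_nat_rational:
  assumes "squarefree k" "sqrt (real k) \<in> \<rat>"
  shows "k = 1"
proof -
  have "sqrt (real k) \<in> \<int>"
    by (rule rational_algebraic_int_is_int[OF _ assms(2)]) auto
  then obtain n where n: "sqrt (real k) = of_int n" by (elim Ints_cases)
  then have "real k = (of_int n)\<^sup>2" by (metis of_nat_0_le_iff real_sqrt_pow2)
  then have "int k = n\<^sup>2" by (metis of_int_eq_iff of_int_of_nat_eq of_int_power)
  then have "k = (nat \<bar>n\<bar>)\<^sup>2" by (metis nat_abs_int_diff nat_int nat_power_eq abs_ge_zero power2_abs)
  then show ?thesis using squarefreeD[OF assms(1), of "nat \<bar>n\<bar>"] by simp
qed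

lemma squarefree_mod_4:
  fixes k :: nat assumes "squarefree k"
  shows "k mod 4 = 1 \<or> k mod 4 = 2 \<or> k mod 4 = 3"
proof -
  have "k mod 4 \<noteq> 0"
  proof
    assume "k mod 4 = 0"
    then have "2\<^sup>2 dvd k" by auto
    from squarefreeD[OF assms this] show False by simp
  qed
  then show ?thesis by linarith
qed

lemma square_mod_4: "(n :: int)\<^sup>2 mod 4 = (if even n then 0 else 1)"
proof (cases "even n")
  case True
  then obtain m where "n = 2 * m" by blast
  then have "n\<^sup>2 = 4 * m\<^sup>2" by (simp add: power2_eq_square)
  then show ?thesis using True by simp
next
  case False
  then obtain m where "n = 2 * m + 1" by (elim oddE)
  then have "n\<^sup>2 = 4 * (m\<^sup>2 + m) + 1" by (simp add: power2_eq_square algebra_simps)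
  then have "n\<^sup>2 mod 4 = 1" by presburger
  then show ?thesis using False by simp
qed

lemma mult_square_mod_4: "(k * n\<^sup>2) mod 4 = (if even n then 0 else k mod (4 :: int))"
proof -
  have "(k * n\<^sup>2) mod 4 = (k * (n\<^sup>2 mod 4)) mod 4" by (simp add: mod_mult_right_eq)
  then show ?thesis by (simp add: square_mod_4)
qed

text \<open>For \<open>y = a / b\<close> in lowest terms, \<open>b\<^sup>2\<close> divides
  \<open>k * a\<^sup>2\<close> and hence the squarefree \<open>k\<close>, so
  \<open>b = 1\<close>.\<close>

lemma squarefree_mult_square_Ints:
  assumes k: "squarefree k" and y: "y \<in> \<rat>" and int: "real k * y\<^sup>2 \<in> \<int>"
  shows "y \<in> \<int>"
proof -
  obtain a b :: int where ab: "b > 0" "coprime a b" "y = of_int a / of_int b"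
    using y by (elim Rats_cases') auto
  obtain n where "real k * y\<^sup>2 = of_int n" using int by (elim Ints_cases)
  then have "real_of_int (int k * a\<^sup>2) = real_of_int (n * b\<^sup>2)"
    using ab by (simp add: field_simps power2_eq_square)
  then have eq: "int k * a\<^sup>2 = n * b\<^sup>2" by (simp only: of_int_eq_iff)
  then have "b\<^sup>2 dvd int k * a\<^sup>2" by simp
  moreover have "coprime (b\<^sup>2) (a\<^sup>2)" using ab(2) by (simp add: coprime_commute)
  ultimately have "b\<^sup>2 dvd int k" by (simp add: coprime_dvd_mult_left_iff)
  then have "(nat b)\<^sup>2 dvd k" using ab(1) by (metis int_dvd_int_iff int_nat_eq less_imp_le of_nat_power)
  from squarefreeD[OF k this] have "b = 1" using ab(1) by simp
  then show ?thesis using ab by simp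
qed

text \<open>The trace \<open>2 * a\<close> and the norm \<open>a\<^sup>2 - k * b\<^sup>2\<close> are
  integers, hence so is \<open>k * (2 * b)\<^sup>2\<close> and, \<open>k\<close> being squarefree,
  \<open>2 * b\<close>. The parities follow from comparing \<open>A\<^sup>2\<close> with
  \<open>k * B\<^sup>2\<close> modulo 4.\<close>

lemma quadratic_integer_coordinates:
  fixes a b :: real and k :: nat
  assumes k: "squarefree k" and ab: "a \<in> \<rat>" "b \<in> \<rat>"
    and int: "algebraic_int (a + b * sqrt k)" "algebraic_int (a - b * sqrt k)"
  obtains A B :: int where "2 * a = A" "2 * b = B" "k mod 4 = 1 \<longrightarrow> even A = even B"
    "k mod 4 \<noteq> 1 \<longrightarrow> even A \<and> even B"
proof -
  have "algebraic_int ((a + b * sqrt k) + (a - b * sqrt k))"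
    using int by (rule algebraic_int_add_mult)
  then have "algebraic_int (2 * a)" by simp
  then have "2 * a \<in> \<int>" using ab by (intro rational_algebraic_int_is_int) auto
  then obtain A :: int where A: "2 * a = A" by (elim Ints_cases)
  have "algebraic_int ((a + b * sqrt k) * (a - b * sqrt k))"
    using int by (rule algebraic_int_add_mult)
  then have "algebraic_int (a\<^sup>2 - k * b\<^sup>2)" by (simp add: algebra_simps power2_eq_square)
  then have "a\<^sup>2 - k * b\<^sup>2 \<in> \<int>" using ab by (intro rational_algebraic_int_is_int) auto
  then obtain n :: int where n: "a\<^sup>2 - k * b\<^sup>2 = n" by (elim Ints_cases)
  have "k * (2 * b)\<^sup>2 = (2 * a)\<^sup>2 - 4 * (a\<^sup>2 - k * b\<^sup>2)" by (simp add: power2_eq_square algebra_simps)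
  also have "\<dots> = of_int (A\<^sup>2 - 4 * n)" by (simp add: A n)
  finally have kb: "k * (2 * b)\<^sup>2 = of_int (A\<^sup>2 - 4 * n)" .
  have "k * (2 * b)\<^sup>2 \<in> \<int>" unfolding kb by (rule Ints_of_int)
  moreover have "2 * b \<in> \<rat>" using ab by simp
  ultimately have "2 * b \<in> \<int>" by (rule squarefree_mult_square_Ints[OF k, rotated])
  then obtain B :: int where B: "2 * b = B" by (elim Ints_cases)
  have "real_of_int (int k * B\<^sup>2) = of_int (A\<^sup>2 - 4 * n)" using kb by (simp add: B)
  then have eq: "int k * B\<^sup>2 = A\<^sup>2 - 4 * n" by (simp only: of_int_eq_iff)
  moreover have "(m - 4 * n) mod 4 = m mod 4" for m by presburger
  ultimately have "(int k * B\<^sup>2) mod 4 = A\<^sup>2 mod 4" by simp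
  then have "(if even B then 0 else int k mod 4) = (if even A then 0 else 1)"
    by (simp only: mult_square_mod_4 square_mod_4)
  moreover have "int k mod 4 = int (k mod 4)" by (simp add: zmod_int)
  ultimately show ?thesis
    using that[OF A B] squarefree_mod_4[OF k] by (auto split: if_splits)
qed

definition omega_trace :: "nat \<Rightarrow> int" where
  "omega_trace k = (if k mod 4 = 1 then 1 else 0)"

text \<open>Minus the norm of \<open>omega k\<close>; in the first case \<open>k div 4\<close> is (k
  - 1) / 4.\<close>

definition omega_norm :: "nat \<Rightarrow> int" where
  "omega_norm k = (if k mod 4 = 1 then int (k div 4) else int k)"

lemma cf_lattice_omega:
  assumes k: "squarefree k" "k \<noteq> 1"
  shows "cf_lattice (- omega_conj k) (omega k) (omega_trace k) (omega_norm k)"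
proof
  have irr: "sqrt (real k) \<notin> \<rat>" using sqrt_nat_rational k by blast
  have "k \<noteq> 0" using k(1) by (intro notI) simp
  then have k2: "k \<ge> 2" using k(2) by linarith
  then have s1: "sqrt (real k) > 1" by simp
  show "- omega_conj k \<notin> \<rat>"
  proof
    assume "- omega_conj k \<in> \<rat>"
    moreover have "sqrt (real k) = (if k mod 4 = 1 then 1 + 2 * (- omega_conj k) else - omega_conj k)"
      by (simp add: omega_conj_def field_simps)
    ultimately have "sqrt (real k) \<in> \<rat>" by (simp split: if_splits)
    then show False using irr by simp
  qed
  show "- omega_conj k > 0" using s1 by (simp add: omega_conj_def)
  show "omega k \<ge> 1" using s1 by (simp add: omega_def)
  show "omega k - (- omega_conj k) = of_int (omega_trace k)"
    by (simp add: omega_def omega_conj_def omega_trace_def field_simps)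
  show "omega k * (- omega_conj k) = of_int (omega_norm k)"
  proof (cases "k mod 4 = 1")
    case True
    then have "k = 4 * (k div 4) + 1" by presburger
    then have "real k = 4 * real (k div 4) + 1" by (metis of_nat_1 of_nat_add of_nat_mult of_nat_numeral)
    then show ?thesis using True
      by (simp add: omega_def omega_conj_def omega_norm_def field_simps)
  qed (simp add: omega_def omega_conj_def omega_norm_def)
qed

lemma omega_coordinates:
  obtains c :: real where "c \<in> \<rat>" "omega k = of_int (omega_trace k) / 2 + c * sqrt k"
    "omega_conj k = of_int (omega_trace k) / 2 - c * sqrt k"
proof (cases "k mod 4 = 1")
  case True
  then show ?thesis using that[of "1/2"] by (simp add: omega_def omega_conj_def omega_trace_def field_simps)
next
  case False
  then show ?thesis using that[of 1] by (simp add: omega_def omega_conj_def omega_trace_def)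
qed

lemma algebraic_int_omega:
  assumes k: "squarefree k" "k \<noteq> 1"
  shows "algebraic_int (omega k)"
proof -
  interpret cf_lattice "- omega_conj k" "omega k" "omega_trace k" "omega_norm k"
    using cf_lattice_omega[OF k] .
  let ?p = "[:- real_of_int (omega_norm k), - real_of_int (omega_trace k), 1:]"
  have "poly ?p (omega k) = 0"
    by (simp add: trace[symmetric] norm[symmetric] algebra_simps)
  moreover have "\<forall>i. coeff ?p i \<in> \<int>"
    by (auto simp: coeff_pCons split: nat.splits)
  ultimately show ?thesis by (intro algebraic_int.intros[of ?p]) auto
qed

lemma quadratic_conj_hom:
  assumes irr: "sqrt (real k) \<notin> \<rat>"
  obtains \<tau> where "real_hom (adj \<rat> (sqrt k)) \<tau>"
    "\<forall>a\<in>\<rat>. \<forall>b\<in>\<rat>. \<tau> (a + b * sqrt k) = a - b * sqrt k"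
proof -
  have "real_hom \<rat> id" by (simp add: real_hom_def)
  then obtain \<tau> where "real_hom (adj \<rat> (sqrt k)) \<tau>"
    "\<And>a b. a \<in> \<rat> \<Longrightarrow> b \<in> \<rat> \<Longrightarrow> \<tau> (a + b * sqrt k) = id a + id b * (- sqrt k)"
    using real_hom_extend[OF real_subfield_Rats sqrt_mult_self_Rats irr, of id "- sqrt k"] by auto
  then show ?thesis using that by simp
qed

lemma real_subfield_quadratic: "real_subfield (adj \<rat> (sqrt (real k)))"
  by (intro real_subfield_adj real_subfield_Rats sqrt_mult_self_Rats)

lemma quadratic_conj_algebraic_int:
  fixes a b :: real
  assumes irr: "sqrt (real k) \<notin> \<rat>" and ab: "a \<in> \<rat>" "b \<in> \<rat>"
    and int: "algebraic_int (a + b * sqrt k)"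
  shows "algebraic_int (a - b * sqrt k)"
proof -
  obtain \<tau> where \<tau>: "real_hom (adj \<rat> (sqrt k)) \<tau>"
    "\<forall>a\<in>\<rat>. \<forall>b\<in>\<rat>. \<tau> (a + b * sqrt k) = a - b * sqrt k"
    using quadratic_conj_hom[OF irr] .
  have "algebraic_int (\<tau> (a + b * sqrt k))"
    by (rule real_hom_algebraic_int[OF real_subfield_quadratic \<tau>(1) _ adjI[OF ab] int])
       (use bspec[OF bspec[OF \<tau>(2)], of _ 0] in simp)
  then show ?thesis using \<tau>(2) ab by simp
qed

text \<open>Any embedding sends \<open>sqrt k\<close> to a square root of \<open>k\<close>, so on
  this field the identity and conjugation account for all embeddings.\<close>

lemma pos_integers_quadratic_iff:
  fixes a b :: real
  assumes irr: "sqrt (real k) \<notin> \<rat>" and ab: "a \<in> \<rat>" "b \<in> \<rat>"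
  shows "a + b * sqrt k \<in> pos_integers_of (rat_adjoin {sqrt k}) \<longleftrightarrow>
    algebraic_int (a + b * sqrt k) \<and> a + b * sqrt k > 0 \<and> a - b * sqrt k > 0"
  (is "?x \<in> ?P \<longleftrightarrow> ?R")
proof
  let ?F = "adj \<rat> (sqrt (real k))"
  assume x: "?x \<in> ?P"
  have "real_hom ?F id" by (simp add: real_hom_def)
  from real_hom_embedding[OF this] x have 1: "?x > 0"
    by (auto simp: pos_integers_of_def rat_adjoin_sqrt)
  obtain \<tau> where \<tau>: "real_hom ?F \<tau>"
    "\<forall>a\<in>\<rat>. \<forall>b\<in>\<rat>. \<tau> (a + b * sqrt k) = a - b * sqrt k"
    using quadratic_conj_hom[OF irr] .
  from real_hom_embedding[OF this(1)] x have "\<tau> ?x > 0"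
    by (auto simp: pos_integers_of_def rat_adjoin_sqrt)
  with 1 x show ?R using \<tau>(2) ab by (auto simp: pos_integers_of_def integers_of_def)
next
  let ?F = "adj \<rat> (sqrt (real k))"
  assume R: ?R
  have "\<sigma> ?x \<in> \<real> \<and> Re (\<sigma> ?x) > 0" if \<sigma>: "\<sigma> \<in> embeddings ?F" for \<sigma>
  proof -
    note h = embeddingsD[OF \<sigma>]
    have QF: "y \<in> ?F" if "y \<in> \<rat>" for y
      using that adj_contains(1)[OF real_subfield_Rats] by blast
    have sF: "sqrt k \<in> ?F" by (rule adj_contains(2)[OF real_subfield_Rats])
    have r: "\<sigma> y = of_real y" if "y \<in> \<rat>" for y
      by (rule embedding_Rats[OF real_subfield_quadratic \<sigma> that])
    have "\<sigma> (sqrt k) * \<sigma> (sqrt k) = \<sigma> (sqrt k * sqrt k)" using h(3)[OF sF sF] by simp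
    also have "\<dots> = of_real (sqrt k * sqrt k)" by (rule r) simp
    finally have "\<sigma> (sqrt k) * \<sigma> (sqrt k) = of_real (sqrt k) * of_real (sqrt k)"
      unfolding of_real_mult .
    then consider "\<sigma> (sqrt k) = of_real (sqrt k)" | "\<sigma> (sqrt k) = of_real (- sqrt k)"
      unfolding square_eq_iff by auto
    moreover have "\<sigma> ?x = of_real a + of_real b * \<sigma> (sqrt k)"
      using h(2)[OF QF[OF ab(1)], of "b * sqrt k"] h(3)[OF QF[OF ab(2)] sF]
        real_subfieldD(6)[OF real_subfield_quadratic QF[OF ab(2)] sF] r ab by simp
    ultimately have "\<sigma> ?x = of_real (a + b * sqrt k) \<or> \<sigma> ?x = of_real (a - b * sqrt k)"
      by cases simp_all
    then show ?thesis using R by (metis Re_complex_of_real Reals_of_real)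
  qed
  moreover have "?x \<in> ?F" using ab by (rule adjI)
  ultimately show "?x \<in> ?P" using R
    by (simp add: pos_integers_of_def integers_of_def rat_adjoin_sqrt)
qed

text \<open>For \<open>k\<close> congruent to 1 modulo 4, half of \<open>A + B * sqrt k\<close> is
  \<open>(A - B) / 2 + B * omega k\<close>, and \<open>A - B\<close> is even.\<close>

lemma quadratic_integer_lattice:
  fixes a b :: real
  assumes k: "squarefree k" "k \<noteq> 1" and ab: "a \<in> \<rat>" "b \<in> \<rat>" and int: "algebraic_int (a + b * sqrt k)"
  obtains A B :: int where "a + b * sqrt k = A + B * omega k" "a - b * sqrt k = A + B * omega_conj k"
proof -
  have irr: "sqrt (real k) \<notin> \<rat>" using sqrt_nat_rational k by blast
  obtain A B :: int where AB: "2 * a = A" "2 * b = B" "k mod 4 = 1 \<longrightarrow> even A = even B"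
    "k mod 4 \<noteq> 1 \<longrightarrow> even A \<and> even B"
    using quadratic_integer_coordinates[OF k(1) ab int quadratic_conj_algebraic_int[OF irr ab int]] .
  have a: "a = A / 2" and b: "b = B / 2" using AB by auto
  show ?thesis
  proof (cases "k mod 4 = 1")
    case True
    then have "even (A - B)" using AB(3) by simp
    then obtain C where "A - B = 2 * C" by (elim evenE)
    then have "A = 2 * C + B" by simp
    then have a': "a = C + B / 2" using a by simp
    have "a + b * sqrt k = C + B * omega k" "a - b * sqrt k = C + B * omega_conj k"
      using True unfolding a' b by (simp_all add: omega_def omega_conj_def algebra_simps add_divide_distrib diff_divide_distrib)
    then show ?thesis by (rule that)
  next
    case False
    then obtain C E where "A = 2 * C" "B = 2 * E" using AB(4) by (metis evenE)
    then show ?thesis using that[of C E] False a b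
      by (simp add: omega_def omega_conj_def)
  qed
qed

section \<open>Integers of a quadratic field as lattice points\<close>

context
  fixes k :: nat
  assumes k: "squarefree k" "k \<noteq> 1"
begin

interpretation cf_lattice "- omega_conj k" "omega k" "omega_trace k" "omega_norm k"
  using cf_lattice_omega[OF k] .

lemma lattice_pos_integers:
  "val A B \<in> pos_integers_of (rat_adjoin {sqrt k}) \<longleftrightarrow> tot_pos A B"
proof -
  have irr: "sqrt (real k) \<notin> \<rat>" using sqrt_nat_rational k by blast
  obtain c :: real where c: "c \<in> \<rat>" "omega k = of_int (omega_trace k) / 2 + c * sqrt k"
    "omega_conj k = of_int (omega_trace k) / 2 - c * sqrt k" by (rule omega_coordinates)
  define a b where "a = real_of_int A + of_int B * of_int (omega_trace k) / 2" and "b = of_int B * c"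
  have ab: "a \<in> \<rat>" "b \<in> \<rat>" using c by (simp_all add: a_def b_def)
  have v: "val A B = a + b * sqrt k" "cnj_val A B = a - b * sqrt k"
  proof -
    have "val A B = A + B * omega k" "cnj_val A B = A + B * omega_conj k"
      by (simp_all add: val_def cnj_val_def)
    then show "val A B = a + b * sqrt k" "cnj_val A B = a - b * sqrt k"
      unfolding a_def b_def by (simp_all only: c(2,3)) (simp_all add: algebra_simps)
  qed
  have "algebraic_int (val A B)" unfolding val_def
    by (intro algebraic_int_add_mult algebraic_int_omega k) auto
  then show ?thesis
    using pos_integers_quadratic_iff[OF irr ab] by (simp add: tot_pos_def v)
qed

lemma indecomposable_imp_lattice:
  assumes "indecomposable_in (rat_adjoin {sqrt k}) (val A B)"
  shows "lattice_indecomposable A B"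
  unfolding lattice_indecomposable_def
proof (intro conjI notI)
  show "tot_pos A B" using assms lattice_pos_integers by (simp add: indecomposable_in_def)
  assume "\<exists>A1 B1 A2 B2. tot_pos A1 B1 \<and> tot_pos A2 B2 \<and> A = A1 + A2 \<and> B = B1 + B2"
  then obtain A1 B1 A2 B2 where *: "tot_pos A1 B1" "tot_pos A2 B2" "A = A1 + A2" "B = B1 + B2" by blast
  then have "val A B = val A1 B1 + val A2 B2" by (simp add: val_def algebra_simps)
  moreover have "val A1 B1 \<in> pos_integers_of (rat_adjoin {sqrt k})"
    "val A2 B2 \<in> pos_integers_of (rat_adjoin {sqrt k})" using * lattice_pos_integers by auto
  ultimately show False using assms unfolding indecomposable_in_def by blast
qed

lemma omega_convergent_eq:
  "omega_convergent k i = val (cf_num (- omega_conj k) (Suc i)) (cf_den (- omega_conj k) (Suc i))"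
  by (simp add: omega_convergent_def quotient_of_cf_convergent[OF irrational] val_def
      del: cf_num.simps cf_den.simps)

text \<open>The two box lemmas, for convergents and for general indecomposables, carried over from
  the lattice to the quadratic field.\<close>

lemma omega_box:
  fixes \<theta> a b :: real and A' B' :: int
  assumes ab: "a \<in> \<rat>" "b \<in> \<rat>"
    and indec: "indecomposable_in (rat_adjoin {sqrt k}) (a + b * sqrt k)"
    and \<theta>: "(is_omega_convergent k (a + b * sqrt k) \<and> \<theta> > 1) \<or> \<theta> > M_odd k"
    and less: "\<theta> * \<bar>A' + B' * omega k\<bar> < a + b * sqrt k" "\<theta> * \<bar>A' + B' * omega_conj k\<bar> < a - b * sqrt k"
  shows "A' = 0 \<and> B' = 0"
proof -
  have irr: "sqrt (real k) \<notin> \<rat>" using sqrt_nat_rational k by blast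
  have pos: "a + b * sqrt k \<in> pos_integers_of (rat_adjoin {sqrt k})"
    using indec by (simp add: indecomposable_in_def)
  then have int: "algebraic_int (a + b * sqrt k)" by (simp add: pos_integers_of_def integers_of_def)
  obtain A B :: int where AB: "a + b * sqrt k = A + B * omega k" "a - b * sqrt k = A + B * omega_conj k"
    using quadratic_integer_lattice[OF k ab int] .
  have v: "a + b * sqrt k = val A B" "a - b * sqrt k = cnj_val A B" using AB by (simp_all add: val_def cnj_val_def)
  have v': "\<bar>A' + B' * omega k\<bar> = \<bar>val A' B'\<bar>" "\<bar>A' + B' * omega_conj k\<bar> = \<bar>cnj_val A' B'\<bar>"
    by (simp_all add: val_def cnj_val_def)
  \<comment> \<open>A smaller factor weakens the box condition, so \<open>\<theta>\<close> may be
    lowered to 1 or to \<open>M_odd k\<close>.\<close>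
  have lt: "M * \<bar>val A' B'\<bar> < val A B" "M * \<bar>cnj_val A' B'\<bar> < cnj_val A B" if "M \<le> \<theta>" for M
    using less mult_right_mono[OF that, of "\<bar>val A' B'\<bar>"] mult_right_mono[OF that, of "\<bar>cnj_val A' B'\<bar>"]
    unfolding v v' by linarith+
  from \<theta> show ?thesis
  proof
    assume *: "is_omega_convergent k (a + b * sqrt k) \<and> \<theta> > 1"
    then obtain i where i: "val A B = val (cf_num (- omega_conj k) (Suc i)) (cf_den (- omega_conj k) (Suc i))"
      unfolding is_omega_convergent_def omega_convergent_eq v by blast
    have "A = cf_num (- omega_conj k) (Suc i) \<and> B = cf_den (- omega_conj k) (Suc i)"
      by (rule val_inj[OF i])
    then show ?thesis
      using convergent_box[of "Suc i" A' B'] lt[of 1] * pos lattice_pos_integers[of A B]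
      by (simp add: v tot_pos_def del: cf_num.simps cf_den.simps)
  next
    assume *: "\<theta> > M_odd k"
    show ?thesis
      by (rule indecomposable_box[of A B "M_odd k"])
         (use indec lt[of "M_odd k"] * odd_partial_quotient_le_Max in
           \<open>auto simp: v M_odd_def intro!: indecomposable_imp_lattice\<close>)
  qed
qed

end

section \<open>Biquadratic fields\<close>

lemma real_subfield_imp_subfield:
  assumes "real_subfield F" shows "subfield F real_ring"
proof -
  have "F = generate_field real_ring F"
    using rat_adjoin_subset[OF assms, of F] rat_adjoin_incl[of F] by (auto simp: rat_adjoin_def)
  then show ?thesis
    using field.generate_field_is_subfield[OF field_from_type_algebra, of F] by simp
qed

section \<open>Nondegeneracy from the degree\<close>

lemma adj_eq:
  assumes F: "real_subfield F" and "s \<in> F"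
  shows "adj F s = F"
  using adj_minimal[OF F, of F s] adj_contains(1)[OF F, of s] assms(2) by auto

text \<open>The set is the rational span of 1 and \<open>s\<close>; adjoining a line raises the
  dimension by at most one.\<close>

lemma rat_degree_adj_Rats:
  assumes "has_rat_degree (adj \<rat> s) n"
  shows "n \<le> 2"
proof -
  interpret ring real_ring by (rule ring_from_type_algebra)
  have K: "subfield \<rat> real_ring" by (rule real_subfield_imp_subfield[OF real_subfield_Rats])
  have n: "dimension n \<rat> (adj \<rat> s)" using assms by (simp add: has_rat_degree_def)
  show ?thesis
  proof (cases "s \<in> \<rat>")
    case True
    then have "dimension 1 \<rat> (adj \<rat> s)"
      using dimension_one[OF K] adj_eq[OF real_subfield_Rats] by simp
    from dimension_is_inj[OF K n this] show ?thesis by simp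
  next
    case False
    have "line_extension \<rat> s \<rat> = adj \<rat> s"
    proof -
      have "x \<in> line_extension \<rat> s \<rat> \<longleftrightarrow> x \<in> adj \<rat> s" for x
        unfolding line_extension_mem_iff adj_def by (auto simp: add.commute)
      then show ?thesis by blast
    qed
    then have "dimension (Suc 1) \<rat> (adj \<rat> s)"
      using Suc_dim[OF _ False dimension_one[OF K]] by simp
    from dimension_is_inj[OF K n this] show ?thesis by simp
  qed
qed

text \<open>In each degenerate case \<open>K\<close> would be spanned by 1 and a single square root,
  against degree 4.\<close>

lemma biquadratic_nondegenerate:
  assumes "has_rat_degree (rat_adjoin {sqrt (real p), sqrt (real q)}) 4"
  shows "p \<noteq> 1" "q \<noteq> 1" "p \<noteq> q"
proof -
  let ?K = "rat_adjoin {sqrt (real p), sqrt (real q)}"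
  have no: "?K \<noteq> adj \<rat> s" for s
    using rat_degree_adj_Rats[of s 4] assms by auto
  note F = real_subfield_quadratic[of p]
  show "p \<noteq> 1"
  proof
    assume "p = 1"
    then have "?K = adj \<rat> (sqrt (real q))"
      unfolding rat_adjoin_sqrt2 by (simp add: adj_eq real_subfield_Rats)
    then show False using no by blast
  qed
  show "q \<noteq> 1"
  proof
    assume "q = 1"
    then have "?K = adj \<rat> (sqrt (real p))"
      unfolding rat_adjoin_sqrt2 by (intro adj_eq F) (simp add: real_subfieldD[OF F])
    then show False using no by blast
  qed
  show "p \<noteq> q"
  proof
    assume "p = q"
    then have "?K = adj \<rat> (sqrt (real p))"
      unfolding rat_adjoin_sqrt2 by (intro adj_eq F) (simp add: adj_contains(2)[OF real_subfield_Rats])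
    then show False using no by blast
  qed
qed

section \<open>Coordinates of totally positive integers of K\<close>

definition pos_int :: "real \<Rightarrow> bool" where
  "pos_int x \<longleftrightarrow> algebraic_int x \<and> x > 0"

text \<open>The product of any two of the square roots is a rational multiple of the third, so the
  admissible sign changes are those whose product is \<open>1\<close>.\<close>

definition pos_conjugates :: "nat \<Rightarrow> nat \<Rightarrow> nat \<Rightarrow> real \<Rightarrow> real \<Rightarrow> real \<Rightarrow> real \<Rightarrow> bool" where
  "pos_conjugates k m t a b c d \<longleftrightarrow>
     pos_int (a + b * sqrt k + c * sqrt m + d * sqrt t) \<and>
     pos_int (a + b * sqrt k - c * sqrt m - d * sqrt t) \<and>
     pos_int (a - b * sqrt k + c * sqrt m - d * sqrt t) \<and>
     pos_int (a - b * sqrt k - c * sqrt m + d * sqrt t)"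

text \<open>The relation between the three square roots is deliberately left out, so that the roles of the
  three quadratic subfields can be permuted.\<close>

locale biquadratic =
  fixes k m t :: nat and K :: "real set"
  assumes squarefree: "squarefree k" "squarefree m" "squarefree t"
    and neq_1: "k \<noteq> 1" "m \<noteq> 1" "t \<noteq> 1"
    and coordinates: "x \<in> pos_integers_of K \<Longrightarrow> \<exists>a\<in>\<rat>. \<exists>b\<in>\<rat>. \<exists>c\<in>\<rat>. \<exists>d\<in>\<rat>.
      x = a + b * sqrt k + c * sqrt m + d * sqrt t \<and> pos_conjugates k m t a b c d"
    and independent: "a \<in> \<rat> \<Longrightarrow> b \<in> \<rat> \<Longrightarrow> c \<in> \<rat> \<Longrightarrow> d \<in> \<rat> \<Longrightarrow>
      a + b * sqrt k + c * sqrt m + d * sqrt t = 0 \<Longrightarrow> a = 0 \<and> b = 0 \<and> c = 0 \<and> d = 0"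
    and subfields: "rat_adjoin {sqrt k} \<subseteq> K" "rat_adjoin {sqrt m} \<subseteq> K" "rat_adjoin {sqrt t} \<subseteq> K"

lemma biquadratic_swap12:
  assumes "biquadratic k m t K" shows "biquadratic m k t K"
proof -
  interpret biquadratic k m t K by fact
  show ?thesis
  proof
    fix x assume "x \<in> pos_integers_of K"
    from coordinates[OF this] obtain a b c d where *: "a \<in> \<rat>" "b \<in> \<rat>" "c \<in> \<rat>" "d \<in> \<rat>"
      "x = a + b * sqrt k + c * sqrt m + d * sqrt t" "pos_conjugates k m t a b c d" by blast
    then have "x = a + c * sqrt m + b * sqrt k + d * sqrt t" "pos_conjugates m k t a c b d"
      by (simp_all add: pos_conjugates_def algebra_simps)
    with * show "\<exists>a\<in>\<rat>. \<exists>b\<in>\<rat>. \<exists>c\<in>\<rat>. \<exists>d\<in>\<rat>.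
      x = a + b * sqrt m + c * sqrt k + d * sqrt t \<and> pos_conjugates m k t a b c d" by blast
  next
    fix a b c d :: real assume "a \<in> \<rat>" "b \<in> \<rat>" "c \<in> \<rat>" "d \<in> \<rat>" "a + b * sqrt m + c * sqrt k + d * sqrt t = 0"
    then show "a = 0 \<and> b = 0 \<and> c = 0 \<and> d = 0" using independent[of a c b d] by (simp add: add_ac)
  qed (use squarefree neq_1 subfields in auto)
qed

lemma biquadratic_swap23:
  assumes "biquadratic k m t K" shows "biquadratic k t m K"
proof -
  interpret biquadratic k m t K by fact
  show ?thesis
  proof
    fix x assume "x \<in> pos_integers_of K"
    from coordinates[OF this] obtain a b c d where *: "a \<in> \<rat>" "b \<in> \<rat>" "c \<in> \<rat>" "d \<in> \<rat>"
      "x = a + b * sqrt k + c * sqrt m + d * sqrt t" "pos_conjugates k m t a b c d" by blast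
    then have "x = a + b * sqrt k + d * sqrt t + c * sqrt m" "pos_conjugates k t m a b d c"
      by (simp_all add: pos_conjugates_def algebra_simps)
    with * show "\<exists>a\<in>\<rat>. \<exists>b\<in>\<rat>. \<exists>c\<in>\<rat>. \<exists>d\<in>\<rat>.
      x = a + b * sqrt k + c * sqrt t + d * sqrt m \<and> pos_conjugates k t m a b c d" by blast
  next
    fix a b c d :: real assume "a \<in> \<rat>" "b \<in> \<rat>" "c \<in> \<rat>" "d \<in> \<rat>" "a + b * sqrt k + c * sqrt t + d * sqrt m = 0"
    then show "a = 0 \<and> b = 0 \<and> c = 0 \<and> d = 0" using independent[of a b d c] by (simp add: add_ac)
  qed (use squarefree neq_1 subfields in auto)
qed

text \<open>The hypotheses are the positivity of the four conjugates of each summand, the parts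
  \<open>v\<close> and \<open>w\<close> of the second being opposite to those of the first. Paired,
  they bound the mixed part by each summand, and adding gives the factor 2.\<close>

lemma conjugate_bounds:
  fixes x y v w x' y' :: real
  assumes "0 < x + y + v + w" "0 < x + y - v - w" "0 < x - y + v - w" "0 < x - y - v + w"
    "0 < x' + y' - v - w" "0 < x' + y' + v + w" "0 < x' - y' - v + w" "0 < x' - y' + v - w"
  shows "2 * \<bar>w + v\<bar> < x + x' + (y + y')" "2 * \<bar>w - v\<bar> < x + x' - (y + y')"
  using assms by (simp_all add: abs_if)

context biquadratic
begin

text \<open>The relative trace \<open>2 * a + 2 * b * sqrt k\<close> and its conjugate are sums of
  two conjugates each, hence integral.\<close>

lemma relative_trace_coordinates:
  fixes a b c d :: real
  assumes rat: "a \<in> \<rat>" "b \<in> \<rat>" "c \<in> \<rat>" "d \<in> \<rat>" and pos: "pos_conjugates k m t a b c d"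
  obtains A B :: int where "4 * a = A" "4 * b = B"
    "k mod 4 = 1 \<longrightarrow> even A = even B" "k mod 4 \<noteq> 1 \<longrightarrow> even A \<and> even B"
proof -
  have p: "algebraic_int (a + b * sqrt k + c * sqrt m + d * sqrt t)"
    "algebraic_int (a + b * sqrt k - c * sqrt m - d * sqrt t)"
    "algebraic_int (a - b * sqrt k + c * sqrt m - d * sqrt t)"
    "algebraic_int (a - b * sqrt k - c * sqrt m + d * sqrt t)"
    using pos unfolding pos_conjugates_def pos_int_def by blast+
  from algebraic_int_add_mult(1)[OF p(1,2)] algebraic_int_add_mult(1)[OF p(3,4)]
  have int: "algebraic_int (2 * a + (2 * b) * sqrt k)" "algebraic_int (2 * a - (2 * b) * sqrt k)"
    by (simp_all add: algebra_simps)
  have "2 * a \<in> \<rat>" "2 * b \<in> \<rat>" using rat by auto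
  from quadratic_integer_coordinates[OF squarefree(1) this int] that show ?thesis by auto
qed

text \<open>Permuting the square roots gives the relative traces to all three subfields; they share
  the coordinate \<open>a\<close>, which links their parities.\<close>

lemma integer_coordinates:
  fixes a b c d :: real
  assumes rat: "a \<in> \<rat>" "b \<in> \<rat>" "c \<in> \<rat>" "d \<in> \<rat>" and pos: "pos_conjugates k m t a b c d"
  obtains A B C D :: int where "4 * a = A" "4 * b = B" "4 * c = C" "4 * d = D"
    "even A = even B" "even A = even C" "even A = even D"
    "k mod 4 \<noteq> 1 \<or> m mod 4 \<noteq> 1 \<or> t mod 4 \<noteq> 1 \<longrightarrow> even A"
proof -
  interpret m: biquadratic m k t K using biquadratic_swap12 biquadratic_axioms .
  interpret t: biquadratic t k m K
    using biquadratic_swap12[OF biquadratic_swap23[OF biquadratic_axioms]] .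
  have "pos_conjugates m k t a c b d" "pos_conjugates t k m a d b c"
    using pos by (simp_all add: pos_conjugates_def algebra_simps)
  note swapped = this
  obtain A B :: int where A: "4 * a = A" "4 * b = B" "k mod 4 = 1 \<longrightarrow> even A = even B"
    "k mod 4 \<noteq> 1 \<longrightarrow> even A \<and> even B"
    using relative_trace_coordinates[OF rat pos] .
  obtain A1 C :: int where C: "4 * a = A1" "4 * c = C" "m mod 4 = 1 \<longrightarrow> even A1 = even C"
    "m mod 4 \<noteq> 1 \<longrightarrow> even A1 \<and> even C"
    using m.relative_trace_coordinates[OF rat(1,3,2,4) swapped(1)] .
  obtain A2 D :: int where D: "4 * a = A2" "4 * d = D" "t mod 4 = 1 \<longrightarrow> even A2 = even D"
    "t mod 4 \<noteq> 1 \<longrightarrow> even A2 \<and> even D"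
    using t.relative_trace_coordinates[OF rat(1,4,2,3) swapped(2)] .
  have "A1 = A" "A2 = A" using A(1) C(1) D(1) by simp_all
  then show ?thesis using that[of A B C D] A C D by blast
qed

text \<open>When \<open>sqrt k * sqrt t = h * sqrt m\<close>, this is the number \<eta> of the
  introduction, with \<delta> = c sqrt m + d sqrt t. If all radicands are 1 modulo 4, the numerators
  of \<open>c\<close> and \<open>d\<close> have equal parity and odd \<open>h\<close> preserves
  this; otherwise both are even.\<close>

lemma mixed_part_integral:
  fixes a b c d :: real and h :: nat
  assumes rat: "a \<in> \<rat>" "b \<in> \<rat>" "c \<in> \<rat>" "d \<in> \<rat>" and pos: "pos_conjugates k m t a b c d"
    and h: "k mod 4 = 1 \<Longrightarrow> m mod 4 = 1 \<Longrightarrow> t mod 4 = 1 \<Longrightarrow> odd h"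
  obtains A B :: int where "2 * d * h + 2 * c * sqrt k = A + B * omega k"
    "2 * d * h - 2 * c * sqrt k = A + B * omega_conj k"
proof -
  obtain A B C D :: int where I: "4 * a = A" "4 * b = B" "4 * c = C" "4 * d = D"
    "even A = even B" "even A = even C" "even A = even D"
    "k mod 4 \<noteq> 1 \<or> m mod 4 \<noteq> 1 \<or> t mod 4 \<noteq> 1 \<longrightarrow> even A"
    using integer_coordinates[OF rat pos] .
  have cd: "2 * c = C / 2" "2 * d = D / 2" using I by auto
  show ?thesis
  proof (cases "k mod 4 = 1")
    case True
    have "even (D * int h - C)"
    proof (cases "m mod 4 = 1 \<and> t mod 4 = 1")
      case True
      then have "odd h" using h \<open>k mod 4 = 1\<close> by simp
      then show ?thesis using I by simp
    next
      case False
      then show ?thesis using I by simp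
    qed
    then obtain E where "D * int h - C = 2 * E" by (elim evenE)
    then have "D * int h = 2 * E + C" by simp
    then have "real_of_int (D * int h) = of_int (2 * E + C)" by simp
    then have "2 * d * h = E + C / 2" unfolding cd by simp
    then have "2 * d * h + 2 * c * sqrt k = E + C * omega k"
      "2 * d * h - 2 * c * sqrt k = E + C * omega_conj k"
      unfolding cd using True by (simp_all add: omega_def omega_conj_def add_divide_distrib diff_divide_distrib algebra_simps)
    then show ?thesis by (rule that)
  next
    case False
    then have "even C" "even D" using I by auto
    then obtain C' D' where CD: "C = 2 * C'" "D = 2 * D'" by (elim evenE)
    have "2 * d * h + 2 * c * sqrt k = of_int (D' * int h) + C' * omega k"
      "2 * d * h - 2 * c * sqrt k = of_int (D' * int h) + C' * omega_conj k"
      unfolding cd CD using False by (simp_all add: omega_def omega_conj_def)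
    then show ?thesis by (rule that)
  qed
qed

text \<open>The common core of all statements with a size condition: \<open>k\<close> is the
  radicand of the subfield and \<open>m\<close> the one compared with it. The condition turns into a
  lower bound for \<open>\<theta> = sqrt m / sqrt k\<close>.\<close>

lemma indecomposable_lift:
  fixes h :: nat
  assumes h: "h > 0" "sqrt k * sqrt t = h * sqrt m"
    "k mod 4 = 1 \<Longrightarrow> m mod 4 = 1 \<Longrightarrow> t mod 4 = 1 \<Longrightarrow> odd h"
    and indec: "indecomposable_in (rat_adjoin {sqrt k}) \<alpha>"
    and large: "(is_omega_convergent k \<alpha> \<and> sqrt m > sqrt k) \<or> sqrt m > M_odd k * sqrt k"
  shows "indecomposable_in K \<alpha>"
  unfolding indecomposable_in_def
proof (intro conjI notI)
  let ?P = "pos_integers_of (rat_adjoin {sqrt k})"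
  have \<alpha>P: "\<alpha> \<in> ?P" using indec by (simp add: indecomposable_in_def)
  then show "\<alpha> \<in> pos_integers_of K" using pos_integers_of_mono subfields(1) by blast
  from \<alpha>P have "\<alpha> \<in> adj \<rat> (sqrt k)"
    by (simp add: pos_integers_of_def integers_of_def rat_adjoin_sqrt)
  then obtain a0 b0 where \<alpha>: "\<alpha> = a0 + b0 * sqrt k" "a0 \<in> \<rat>" "b0 \<in> \<rat>" by (auto simp: adj_def)
  have irr: "sqrt (real k) \<notin> \<rat>" using sqrt_nat_rational[OF squarefree(1)] neq_1 by blast
  have "k \<noteq> 0" using squarefree(1) by (intro notI) simp
  then have sk: "sqrt (real k) > 0" by simp
  assume "\<exists>y\<in>pos_integers_of K. \<exists>z\<in>pos_integers_of K. \<alpha> = y + z"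
  then obtain y z where yz: "y \<in> pos_integers_of K" "z \<in> pos_integers_of K" "\<alpha> = y + z" by blast
  from coordinates[OF yz(1)] obtain a b c d where y: "a \<in> \<rat>" "b \<in> \<rat>" "c \<in> \<rat>" "d \<in> \<rat>"
    "y = a + b * sqrt k + c * sqrt m + d * sqrt t" "pos_conjugates k m t a b c d" by blast
  from coordinates[OF yz(2)] obtain a' b' c' d' where z: "a' \<in> \<rat>" "b' \<in> \<rat>" "c' \<in> \<rat>" "d' \<in> \<rat>"
    "z = a' + b' * sqrt k + c' * sqrt m + d' * sqrt t" "pos_conjugates k m t a' b' c' d'" by blast
  have "(a + a' - a0) + (b + b' - b0) * sqrt k + (c + c') * sqrt m + (d + d') * sqrt t = 0"
    using yz(3) \<alpha>(1) y(5) z(5) by (simp add: algebra_simps)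
  from independent[OF _ _ _ _ this] y z \<alpha>
  have sum: "a0 = a + a'" "b0 = b + b'" "c' = - c" "d' = - d" by (auto simp: eq_neg_iff_add_eq_0 add.commute)
  have bound: "2 * \<bar>d * sqrt t + c * sqrt m\<bar> < a0 + b0 * sqrt k" "2 * \<bar>d * sqrt t - c * sqrt m\<bar> < a0 - b0 * sqrt k"
  proof -
    have 1: "0 < a + b * sqrt k + c * sqrt m + d * sqrt t" "0 < a + b * sqrt k - c * sqrt m - d * sqrt t"
      "0 < a - b * sqrt k + c * sqrt m - d * sqrt t" "0 < a - b * sqrt k - c * sqrt m + d * sqrt t"
      "0 < a' + b' * sqrt k + c' * sqrt m + d' * sqrt t" "0 < a' + b' * sqrt k - c' * sqrt m - d' * sqrt t"
      "0 < a' - b' * sqrt k + c' * sqrt m - d' * sqrt t" "0 < a' - b' * sqrt k - c' * sqrt m + d' * sqrt t"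
      using y(6) z(6) unfolding pos_conjugates_def pos_int_def by blast+
    have 2: "b0 * sqrt k = b * sqrt k + b' * sqrt k" "c' * sqrt m = - (c * sqrt m)"
      "d' * sqrt t = - (d * sqrt t)" by (simp_all add: sum distrib_right)
    from conjugate_bounds[OF 1[unfolded 2 add_uminus_conv_diff diff_minus_eq_add]]
    show "2 * \<bar>d * sqrt t + c * sqrt m\<bar> < a0 + b0 * sqrt k"
      "2 * \<bar>d * sqrt t - c * sqrt m\<bar> < a0 - b0 * sqrt k"
      unfolding 2 sum(1) .
  qed
  define \<theta> where "\<theta> = sqrt m / sqrt k"
  have \<theta>k: "\<theta> * sqrt k = sqrt m" using sk by (simp add: \<theta>_def)
  have \<theta>h: "\<theta> * h = sqrt t"
  proof -
    have "\<theta> * h = (sqrt k * sqrt t) / sqrt k" by (simp add: \<theta>_def h(2) mult.commute)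
    then show ?thesis using sk by simp
  qed
  \<comment> \<open>Since \<open>sqrt m\<close> and \<open>sqrt t\<close> are
    \<open>\<theta>\<close> times \<open>sqrt k\<close> and \<open>h\<close>, the factor
    \<open>\<theta>\<close> splits off and leaves an integer of the quadratic field.\<close>
  have eta: "2 * (d * sqrt t + c * sqrt m) = \<theta> * (2 * d * h + 2 * c * sqrt k)"
    "2 * (d * sqrt t - c * sqrt m) = \<theta> * (2 * d * h - 2 * c * sqrt k)"
    unfolding \<theta>k[symmetric] \<theta>h[symmetric] by (simp_all only: ring_distribs mult_ac)
  obtain A B :: int where AB: "2 * d * h + 2 * c * sqrt k = A + B * omega k"
    "2 * d * h - 2 * c * sqrt k = A + B * omega_conj k"
    using mixed_part_integral[OF y(1-4,6) h(3)] .
  have \<theta>0: "\<theta> \<ge> 0" by (simp add: \<theta>_def)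
  have absm: "2 * \<bar>x\<bar> = \<theta> * \<bar>w\<bar>" if "2 * x = \<theta> * w" for x w
  proof -
    have "2 * \<bar>x\<bar> = \<bar>2 * x\<bar>" by simp
    then show ?thesis using \<theta>0 by (simp add: that abs_mult)
  qed
  have less: "\<theta> * \<bar>A + B * omega k\<bar> < a0 + b0 * sqrt k" "\<theta> * \<bar>A + B * omega_conj k\<bar> < a0 - b0 * sqrt k"
    using bound unfolding absm[OF eta(1)] absm[OF eta(2)] AB .
  have "(is_omega_convergent k (a0 + b0 * sqrt k) \<and> \<theta> > 1) \<or> \<theta> > M_odd k"
    using large sk unfolding \<alpha>(1) \<theta>_def by (simp add: pos_less_divide_eq)
  from omega_box[OF squarefree(1) neq_1(1) \<alpha>(2,3) indec[unfolded \<alpha>(1)] this less]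
  have "A = 0 \<and> B = 0" .
  then have 0: "2 * d * h + 2 * c * sqrt k = 0" "2 * d * h - 2 * c * sqrt k = 0" using AB by simp_all
  then have "c * sqrt k = 0" "d * h = 0" by linarith+
  then have cd: "c = 0" "d = 0" using sk h(1) by simp_all
  have "y \<in> ?P" "z \<in> ?P"
    using y z pos_integers_quadratic_iff[OF irr, of a b] pos_integers_quadratic_iff[OF irr, of a' b']
    by (simp_all add: cd sum pos_conjugates_def pos_int_def)
  then show False using indec yz(3) unfolding indecomposable_in_def by blast
qed

end

section \<open>Integrality of half the relative trace\<close>

text \<open>For an integer \<open>(x + y * sqrt p + z * sqrt q + w * sqrt r) / 2\<close>, the
  hypotheses \<open>norm\<close> and \<open>even\<close> say that its relative norm to Q(sqrt p) has
  integral rational part and integral coefficient of \<open>sqrt p\<close>. As squares are 0 or 1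
  modulo 4, only parities matter.\<close>

lemma parity_from_norm:
  fixes p q r x y z w n q' :: int
  assumes cases: "p mod 4 = 2 \<and> q mod 4 = 3 \<and> r mod 4 = 2 \<or> p mod 4 = 2 \<and> q mod 4 = 1 \<and> r mod 4 = 2 \<or>
      p mod 4 = 3 \<and> q mod 4 = 1 \<and> r mod 4 = 3"
    and norm: "x\<^sup>2 + p * y\<^sup>2 - q * z\<^sup>2 - r * w\<^sup>2 = 4 * n" and even: "even (x * y - q' * z * w)"
    and q': "odd q'"
  shows "even x = even z \<and> (q mod 4 = 3 \<longrightarrow> even x)"
proof -
  define X2 Y2 Z2 W2 where "X2 = x\<^sup>2" and "Y2 = p * y\<^sup>2" and "Z2 = q * z\<^sup>2" and "W2 = r * w\<^sup>2"
  have m: "X2 mod 4 = (if even x then 0 else 1)" "Y2 mod 4 = (if even y then 0 else p mod 4)"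
    "Z2 mod 4 = (if even z then 0 else q mod 4)" "W2 mod 4 = (if even w then 0 else r mod 4)"
    by (simp_all add: X2_def Y2_def Z2_def W2_def mult_square_mod_4 square_mod_4)
  have n: "X2 + Y2 - Z2 - W2 = 4 * n" using norm by (simp add: X2_def Y2_def Z2_def W2_def)
  have e: "(even x \<or> even y) = (even z \<or> even w)" using even q' by simp
  have n': "(X2 mod 4 + Y2 mod 4 - Z2 mod 4 - W2 mod 4) mod 4 = 0"
  proof -
    have "(X2 mod 4 + Y2 mod 4 - Z2 mod 4 - W2 mod 4) mod 4 = (X2 + Y2 - Z2 - W2) mod 4"
      by (intro mod_diff_cong mod_add_cong mod_mod_trivial)
    then show ?thesis by (simp add: n)
  qed
  \<comment> \<open>Parities and residues are abstracted to variables, so that a finite case check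
    decides the claim.\<close>
  have *: "ex = ez \<and> (qm = 3 \<longrightarrow> ex)"
    if "((if ex then 0 else 1) + (if ey then 0 else pm) - (if ez then 0 else qm) - (if ew then 0 else rm)) mod (4 :: int) = 0"
      "(ex \<or> ey) = (ez \<or> ew)"
      "pm = 2 \<and> qm = 3 \<and> rm = 2 \<or> pm = 2 \<and> qm = 1 \<and> rm = 2 \<or> pm = 3 \<and> qm = 1 \<and> rm = 3"
    for ex ey ez ew and pm qm rm :: int
    using that(3,1,2)
    by (elim disjE conjE; cases ex; cases ey; cases ez; cases ew; simp)
  show ?thesis by (rule *[OF n'[unfolded m] e cases])
qed

context biquadratic
begin

text \<open>The relative trace to Q(sqrt m) is twice this number. That the half is integral comes
  from the relative norm to Q(sqrt k): its coordinates \<open>N\<close> and \<open>T\<close> are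
  integers because \<open>k\<close> is not 1 modulo 4.\<close>

lemma half_trace_integral:
  fixes a b c d :: real and t' :: nat
  assumes rat: "a \<in> \<rat>" "b \<in> \<rat>" "c \<in> \<rat>" "d \<in> \<rat>" and pos: "pos_conjugates k m t a b c d"
    and t': "sqrt m * sqrt t = t' * sqrt k" "odd t'"
    and cases: "k mod 4 = 2 \<and> m mod 4 = 3 \<and> t mod 4 = 2 \<or> k mod 4 = 2 \<and> m mod 4 = 1 \<and> t mod 4 = 2 \<or>
      k mod 4 = 3 \<and> m mod 4 = 1 \<and> t mod 4 = 3"
  shows "algebraic_int (a + c * sqrt m)"
proof -
  obtain A B C D :: int where I: "4 * a = A" "4 * b = B" "4 * c = C" "4 * d = D"
    "even A = even B" "even A = even C" "even A = even D"
    "k mod 4 \<noteq> 1 \<or> m mod 4 \<noteq> 1 \<or> t mod 4 \<noteq> 1 \<longrightarrow> even A"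
    using integer_coordinates[OF rat pos] .
  have k1: "k mod 4 \<noteq> 1" using cases by auto
  then have "even A" "even B" "even C" "even D" using I by auto
  then obtain x y z w where "A = 2 * x" "B = 2 * y" "C = 2 * z" "D = 2 * w" by (elim evenE)
  then have half: "a = x / 2" "b = y / 2" "c = z / 2" "d = w / 2" using I by auto
  have p: "algebraic_int (a + b * sqrt k + c * sqrt m + d * sqrt t)"
    "algebraic_int (a + b * sqrt k - c * sqrt m - d * sqrt t)"
    "algebraic_int (a - b * sqrt k + c * sqrt m - d * sqrt t)"
    "algebraic_int (a - b * sqrt k - c * sqrt m + d * sqrt t)"
    using pos unfolding pos_conjugates_def pos_int_def by blast+
  define N T where "N = a\<^sup>2 + k * b\<^sup>2 - m * c\<^sup>2 - t * d\<^sup>2" and "T = 2 * a * b - 2 * c * d * t'"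
  have sq: "sqrt k * sqrt k = k" "sqrt m * sqrt m = m" "sqrt t * sqrt t = t" by simp_all
  \<comment> \<open>The sign \<open>e\<close> treats the relative norm and its conjugate
    together.\<close>
  have "(a + e * b * sqrt k + (c * sqrt m + e * d * sqrt t)) * (a + e * b * sqrt k - (c * sqrt m + e * d * sqrt t))
      = N + e * T * sqrt k" if "e * e = 1" for e
  proof -
    have "(a + e * b * sqrt k + (c * sqrt m + e * d * sqrt t)) * (a + e * b * sqrt k - (c * sqrt m + e * d * sqrt t))
      = a\<^sup>2 + (e * e) * b\<^sup>2 * (sqrt k * sqrt k) + 2 * a * e * b * sqrt k - c\<^sup>2 * (sqrt m * sqrt m)
        - (e * e) * d\<^sup>2 * (sqrt t * sqrt t) - 2 * e * c * d * (sqrt m * sqrt t)"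
      by (simp add: power2_eq_square ring_distribs mult_ac del: real_sqrt_mult_self)
    then show ?thesis unfolding sq t'(1) that N_def T_def by (simp add: algebra_simps)
  qed
  note key = this
  have NT: "(a + b * sqrt k + c * sqrt m + d * sqrt t) * (a + b * sqrt k - c * sqrt m - d * sqrt t) = N + T * sqrt k"
    "(a - b * sqrt k + c * sqrt m - d * sqrt t) * (a - b * sqrt k - c * sqrt m + d * sqrt t) = N - T * sqrt k"
    using key[of 1] key[of "-1"] by (simp_all add: algebra_simps)
  have int: "algebraic_int (N + T * sqrt k)" "algebraic_int (N - T * sqrt k)"
    unfolding NT[symmetric] using p by (auto intro: algebraic_int_add_mult(2))
  have "N \<in> \<rat>" "T \<in> \<rat>" using rat by (simp_all add: N_def T_def)
  from quadratic_integer_coordinates[OF squarefree(1) this int] obtain E F :: int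
    where EF: "2 * N = E" "2 * T = F" "even E" "even F" using k1 by metis
  obtain n where n: "E = 2 * n" using EF(3) by (elim evenE)
  have "real_of_int (x\<^sup>2 + int k * y\<^sup>2 - int m * z\<^sup>2 - int t * w\<^sup>2) = of_int (4 * n)"
    using EF(1) by (simp add: n N_def half power_divide)
  then have 1: "x\<^sup>2 + int k * y\<^sup>2 - int m * z\<^sup>2 - int t * w\<^sup>2 = 4 * n" by (simp only: of_int_eq_iff)
  have "real_of_int (x * y - int t' * z * w) = of_int F"
    using EF(2) by (simp add: T_def half mult_ac)
  then have 2: "x * y - int t' * z * w = F" by (simp only: of_int_eq_iff)
  have cases': "int k mod 4 = 2 \<and> int m mod 4 = 3 \<and> int t mod 4 = 2 \<or> int k mod 4 = 2 \<and> int m mod 4 = 1 \<and> int t mod 4 = 2 \<or>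
      int k mod 4 = 3 \<and> int m mod 4 = 1 \<and> int t mod 4 = 3"
  proof -
    have "int j mod 4 = int (j mod 4)" for j by (simp add: zmod_int)
    then show ?thesis using cases by auto
  qed
  have parity: "even x = even z \<and> (int m mod 4 = 3 \<longrightarrow> even x)"
    by (rule parity_from_norm[OF cases' 1 EF(4)[folded 2]]) (use t'(2) in simp)
  show ?thesis
  proof (cases "m mod 4 = 1")
    case True
    have "even (x - z)" using parity by simp
    then obtain f where "x - z = 2 * f" by (elim evenE)
    then have "x = 2 * f + z" by simp
    then have "a + c * sqrt m = f + z * omega m"
      using True unfolding half by (simp add: omega_def add_divide_distrib algebra_simps)
    then show ?thesis
      by (auto intro!: algebraic_int_add_mult algebraic_int_omega squarefree neq_1)
  next
    case False
    then have "m mod 4 = 3" using cases by auto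
    then have "int m mod 4 = 3" by presburger
    then have "even x" "even z" using parity by auto
    then obtain f g where "x = 2 * f" "z = 2 * g" by (elim evenE)
    then have "a + c * sqrt m = f + g * sqrt m" unfolding half by simp
    then show ?thesis by (auto intro!: algebraic_int_add_mult)
  qed
qed

text \<open>Half of the relative trace is additive, fixes \<open>\<alpha>\<close>, and is totally
  positive because each of its conjugates is the mean of two positive ones.\<close>

lemma indecomposable_lift_half_trace:
  fixes t' :: nat
  assumes t': "sqrt m * sqrt t = t' * sqrt k" "odd t'"
    and cases: "k mod 4 = 2 \<and> m mod 4 = 3 \<and> t mod 4 = 2 \<or> k mod 4 = 2 \<and> m mod 4 = 1 \<and> t mod 4 = 2 \<or>
      k mod 4 = 3 \<and> m mod 4 = 1 \<and> t mod 4 = 3"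
    and indec: "indecomposable_in (rat_adjoin {sqrt m}) \<alpha>"
  shows "indecomposable_in K \<alpha>"
  unfolding indecomposable_in_def
proof (intro conjI notI)
  let ?P = "pos_integers_of (rat_adjoin {sqrt m})"
  have \<alpha>P: "\<alpha> \<in> ?P" using indec by (simp add: indecomposable_in_def)
  then show "\<alpha> \<in> pos_integers_of K" using pos_integers_of_mono subfields(2) by blast
  from \<alpha>P have "\<alpha> \<in> adj \<rat> (sqrt m)"
    by (simp add: pos_integers_of_def integers_of_def rat_adjoin_sqrt)
  then obtain a0 c0 where \<alpha>: "\<alpha> = a0 + c0 * sqrt m" "a0 \<in> \<rat>" "c0 \<in> \<rat>" by (auto simp: adj_def)
  have irr: "sqrt (real m) \<notin> \<rat>" using sqrt_nat_rational[OF squarefree(2)] neq_1 by blast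
  have P: "a + c * sqrt m \<in> ?P"
    if "a \<in> \<rat>" "b \<in> \<rat>" "c \<in> \<rat>" "d \<in> \<rat>" "pos_conjugates k m t a b c d" for a b c d
  proof -
    have "0 < a + b * sqrt k + c * sqrt m + d * sqrt t" "0 < a + b * sqrt k - c * sqrt m - d * sqrt t"
      "0 < a - b * sqrt k + c * sqrt m - d * sqrt t" "0 < a - b * sqrt k - c * sqrt m + d * sqrt t"
      using that(5) unfolding pos_conjugates_def pos_int_def by blast+
    then have "0 < a + c * sqrt m" "0 < a - c * sqrt m" by linarith+
    then show ?thesis
      using half_trace_integral[OF that t' cases] pos_integers_quadratic_iff[OF irr that(1,3)] by simp
  qed
  assume "\<exists>y\<in>pos_integers_of K. \<exists>z\<in>pos_integers_of K. \<alpha> = y + z"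
  then obtain y z where yz: "y \<in> pos_integers_of K" "z \<in> pos_integers_of K" "\<alpha> = y + z" by blast
  from coordinates[OF yz(1)] obtain a b c d where y: "a \<in> \<rat>" "b \<in> \<rat>" "c \<in> \<rat>" "d \<in> \<rat>"
    "y = a + b * sqrt k + c * sqrt m + d * sqrt t" "pos_conjugates k m t a b c d" by blast
  from coordinates[OF yz(2)] obtain a' b' c' d' where z: "a' \<in> \<rat>" "b' \<in> \<rat>" "c' \<in> \<rat>" "d' \<in> \<rat>"
    "z = a' + b' * sqrt k + c' * sqrt m + d' * sqrt t" "pos_conjugates k m t a' b' c' d'" by blast
  have "(a + a' - a0) + (b + b') * sqrt k + (c + c' - c0) * sqrt m + (d + d') * sqrt t = 0"
    using yz(3) \<alpha>(1) y(5) z(5) by (simp add: algebra_simps)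
  from independent[OF _ _ _ _ this] y z \<alpha> have "a0 = a + a'" "c0 = c + c'" by auto
  then have "\<alpha> = (a + c * sqrt m) + (a' + c' * sqrt m)" using \<alpha>(1) by (simp add: algebra_simps)
  with P[OF y(1-4,6)] P[OF z(1-4,6)] indec show False
    unfolding indecomposable_in_def by blast
qed

end

section \<open>The field generated by two square roots\<close>

text \<open>All four conjugates are realised by extending the identity of \<rat> first to Q(sqrt p)
  and then to the whole field, so total positivity yields \<open>pos_conjugates\<close>.\<close>

lemma biquadratic_rat_adjoin:
  fixes p q r g :: nat
  assumes sqf: "squarefree p" "squarefree q" "squarefree r" and neq: "p \<noteq> 1" "q \<noteq> 1" "r \<noteq> 1"
    and g: "g > 0" "sqrt p * sqrt q = g * sqrt r"
  shows "biquadratic p q r (rat_adjoin {sqrt p, sqrt q})"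
proof
  let ?F = "adj \<rat> (sqrt (real p))"
  let ?K = "rat_adjoin {sqrt (real p), sqrt (real q)}"
  note F = real_subfield_quadratic[of p] and f = real_subfieldD[OF real_subfield_quadratic[of p]]
  have irr: "sqrt (real p) \<notin> \<rat>" "sqrt (real q) \<notin> \<rat>" "sqrt (real r) \<notin> \<rat>"
    using sqrt_nat_rational sqf neq by blast+
  have QF: "x \<in> ?F" if "x \<in> \<rat>" for x using that adj_contains(1)[OF real_subfield_Rats] by blast
  have sq: "sqrt (real p) * sqrt (real p) = real p" "sqrt (real q) * sqrt (real q) = real q" by simp_all
  have sr: "sqrt (real r) = sqrt p * sqrt q / g" using g by (simp add: field_simps)
  have qF: "sqrt (real q) \<notin> ?F"
  proof
    assume "sqrt (real q) \<in> ?F"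
    then obtain a b where ab: "sqrt (real q) = a + b * sqrt p" "a \<in> \<rat>" "b \<in> \<rat>" by (auto simp: adj_def)
    have "b \<noteq> 0" using ab irr(2) by auto
    \<comment> \<open>Squaring and the irrationality of \<open>sqrt p\<close> force
      \<open>a = 0\<close>; then \<open>sqrt q\<close> is a rational multiple of
      \<open>sqrt p\<close>, which makes \<open>sqrt r\<close> rational.\<close>
    have "sqrt (real q) * sqrt (real q) = a * a + b * b * (sqrt p * sqrt p) + (2 * a * b) * sqrt p"
      unfolding ab(1) by (simp add: algebra_simps)
    then have "(2 * a * b) * sqrt p = q - a * a - b * b * p" unfolding sq by simp
    then have "(2 * a * b) * sqrt p \<in> \<rat>" using ab by simp
    moreover have "2 * a * b \<in> \<rat>" using ab by simp
    ultimately have "2 * a * b = 0"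
      using irr(1) by (metis Rats_divide nonzero_mult_div_cancel_left)
    then have "sqrt (real q) = b * sqrt p" using ab \<open>b \<noteq> 0\<close> by simp
    then have "sqrt (real r) = b * p / g" unfolding sr by simp
    then show False using irr(3) ab by simp
  qed
  show "squarefree p" "squarefree q" "squarefree r" "p \<noteq> 1" "q \<noteq> 1" "r \<noteq> 1" using sqf neq by auto
  show "rat_adjoin {sqrt (real p)} \<subseteq> ?K" "rat_adjoin {sqrt (real q)} \<subseteq> ?K"
    by (intro rat_adjoin_subset real_subfield_rat_adjoin; use rat_adjoin_incl[of "{sqrt p, sqrt q}"] in simp)+
  have "sqrt p \<in> ?K" "sqrt q \<in> ?K" using rat_adjoin_incl[of "{sqrt p, sqrt q}"] by auto
  moreover have "real g \<in> ?K"
    using Rats_subset_real_subfield[OF real_subfield_rat_adjoin, of "{sqrt p, sqrt q}"] by auto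
  ultimately have "sqrt r \<in> ?K" unfolding sr
    using real_subfieldD(6,8)[OF real_subfield_rat_adjoin, of _ "{sqrt p, sqrt q}"] by blast
  then show "rat_adjoin {sqrt (real r)} \<subseteq> ?K"
    by (intro rat_adjoin_subset real_subfield_rat_adjoin) simp
  show "a = 0 \<and> b = 0 \<and> c = 0 \<and> d = 0"
    if "a \<in> \<rat>" "b \<in> \<rat>" "c \<in> \<rat>" "d \<in> \<rat>" "a + b * sqrt p + c * sqrt q + d * sqrt r = 0" for a b c d
  proof -
    have dg: "d / g \<in> \<rat>" using that by simp
    \<comment> \<open>The relation is read over Q(sqrt p) first, between 1 and
      \<open>sqrt q\<close>, and only then over \<rat>.\<close>
    have 0: "(a + b * sqrt p) + (c + d / g * sqrt p) * sqrt q = 0" using that(5) by (simp add: sr algebra_simps)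
    have "c + d / g * sqrt p = 0"
    proof (rule ccontr)
      assume nz: "c + d / g * sqrt p \<noteq> 0"
      have "sqrt q = - (a + b * sqrt p) / (c + d / g * sqrt p)"
        using 0 nz by (simp add: nonzero_eq_divide_eq mult.commute)
      moreover have "- (a + b * sqrt p) \<in> ?F" "c + d / g * sqrt p \<in> ?F"
        by (intro f(3) adjI that dg)+
      ultimately show False using qF f(8) by metis
    qed
    moreover from this 0 have "a + b * sqrt p = 0" by simp
    moreover have "x = 0 \<and> y = 0" if "x \<in> \<rat>" "y \<in> \<rat>" "x + y * sqrt p = 0" for x y
    proof -
      have "y = 0"
      proof (rule ccontr)
        assume "y \<noteq> 0"
        moreover have "y * sqrt p = - x" using that(3) by linarith
        ultimately have "sqrt p = - x / y" by (metis nonzero_mult_div_cancel_left)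
        then show False using irr(1) that by simp
      qed
      then show ?thesis using that by simp
    qed
    ultimately show ?thesis using that dg g(1) by (metis divide_eq_0_iff of_nat_0_less_iff order_less_irrefl)
  qed
  fix x assume x: "x \<in> pos_integers_of ?K"
  then have "x \<in> adj ?F (sqrt q)" by (simp add: pos_integers_of_def integers_of_def rat_adjoin_sqrt2)
  then obtain a b c e where ab: "a \<in> \<rat>" "b \<in> \<rat>" "c \<in> \<rat>" "e \<in> \<rat>"
    "x = (a + b * sqrt p) + (c + e * sqrt p) * sqrt q" unfolding adj_def by blast
  \<comment> \<open>\<open>i\<close> and \<open>j\<close> are the signs given to
    \<open>sqrt p\<close> and \<open>sqrt q\<close>.\<close>
  have conj: "pos_int ((a + b * (i * sqrt p)) + (c + e * (i * sqrt p)) * (j * sqrt q))"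
    if ij: "i * i = 1" "j * j = 1" for i j :: real
  proof -
    have "real_hom \<rat> id" by (simp add: real_hom_def)
    moreover have "i * sqrt p * (i * sqrt p) = id (sqrt p * sqrt p)"
    proof -
      have "i * sqrt p * (i * sqrt p) = (i * i) * (sqrt p * sqrt p)" by (simp only: mult_ac)
      then show ?thesis by (simp add: ij)
    qed
    ultimately obtain \<sigma> where \<sigma>: "real_hom ?F \<sigma>"
      "\<And>a b. a \<in> \<rat> \<Longrightarrow> b \<in> \<rat> \<Longrightarrow> \<sigma> (a + b * sqrt p) = id a + id b * (i * sqrt p)"
      using real_hom_extend[OF real_subfield_Rats sqrt_mult_self_Rats irr(1)] by metis
    have q: "sqrt q * sqrt q \<in> ?F" by (rule QF) simp
    have "j * sqrt q * (j * sqrt q) = \<sigma> (sqrt q * sqrt q)"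
    proof -
      have "j * sqrt q * (j * sqrt q) = (j * j) * (sqrt q * sqrt q)" by (simp only: mult_ac)
      moreover have "\<sigma> (real q) = real q" using \<sigma>(2)[of "real q" 0] by simp
      ultimately show ?thesis unfolding sq by (simp add: ij)
    qed
    from real_hom_extend[OF F q qF \<sigma>(1) this] obtain \<tau> where \<tau>: "real_hom (adj ?F (sqrt q)) \<tau>"
      "\<And>a b. a \<in> ?F \<Longrightarrow> b \<in> ?F \<Longrightarrow> \<tau> (a + b * sqrt q) = \<sigma> a + \<sigma> b * (j * sqrt q)" by metis
    have \<tau>x: "\<tau> x = (a + b * (i * sqrt p)) + (c + e * (i * sqrt p)) * (j * sqrt q)"
      unfolding ab(5) by (subst \<tau>(2)) (use ab in \<open>auto intro: adjI simp: \<sigma>(2)\<close>)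
    have "\<tau> y = y" if "y \<in> \<rat>" for y
      using \<tau>(2)[OF QF[OF that] f(2)] \<sigma>(2)[OF that, of 0] \<sigma>(2)[of 0 0] by simp
    then have "algebraic_int (\<tau> x)"
      using x by (intro real_hom_algebraic_int[OF real_subfield_rat_adjoin \<tau>(1)[folded rat_adjoin_sqrt2]])
        (auto simp: pos_integers_of_def integers_of_def)
    moreover have "\<tau> x > 0"
      using real_hom_embedding[OF \<tau>(1)[folded rat_adjoin_sqrt2]] x by (auto simp: pos_integers_of_def)
    ultimately show ?thesis unfolding \<tau>x pos_int_def by blast
  qed
  \<comment> \<open>As \<open>sqrt p * sqrt q = g * sqrt r\<close>, the coefficient \<open>e\<close>
    of the product becomes \<open>e * g\<close> for \<open>sqrt r\<close>.\<close>
  have "x = a + b * sqrt p + c * sqrt q + (e * g) * sqrt r"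
    using g by (simp add: ab(5) sr algebra_simps)
  moreover have "pos_conjugates p q r a b c (e * g)"
    using conj[of 1 1] conj[of 1 "-1"] conj[of "-1" 1] conj[of "-1" "-1"] g(1)
    by (simp add: pos_conjugates_def sr algebra_simps)
  moreover have "e * g \<in> \<rat>" using ab by simp
  ultimately show "\<exists>a\<in>\<rat>. \<exists>b\<in>\<rat>. \<exists>c\<in>\<rat>. \<exists>d\<in>\<rat>.
      x = a + b * sqrt p + c * sqrt q + d * sqrt r \<and> pos_conjugates p q r a b c d"
    using ab by blast
qed

section \<open>Application to the three quadratic subfields\<close>

lemma sqrt_mult_sqrt:
  fixes a b c h :: nat
  assumes "a * b = h\<^sup>2 * c"
  shows "sqrt a * sqrt b = h * sqrt c"
proof -
  have "sqrt a * sqrt b = sqrt (real (a * b))" by (simp add: real_sqrt_mult)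
  also have "\<dots> = h * sqrt c" unfolding assms by (simp add: real_sqrt_mult)
  finally show ?thesis .
qed

theorem theorem1p1:
  fixes p q r :: nat and K :: "real set"
  assumes "p > 0" and "squarefree p" and "q > 0" and "squarefree q"
    and "K = rat_adjoin {sqrt (real p), sqrt (real q)}"
    and "has_rat_degree K 4"
    and "r = p * q div (gcd p q)\<^sup>2"
    and "(p mod 4 = 2 \<and> q mod 4 = 3) \<or> (p mod 4 = 2 \<and> q mod 4 = 1) \<or>
         (p mod 4 = 3 \<and> q mod 4 = 1) \<or> (p mod 4 = 1 \<and> q mod 4 = 1)"
  shows
    "(\<forall>\<alpha>. indecomposable_in (rat_adjoin {sqrt (real p)}) \<alpha> \<longrightarrow>
        (is_omega_convergent p \<alpha> \<and> sqrt (real r) > sqrt (real p) \<longrightarrow> indecomposable_in K \<alpha>) \<and>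
        (sqrt (real r) > of_int (M_odd p) * sqrt (real p) \<longrightarrow> indecomposable_in K \<alpha>)) \<and>
     (\<forall>\<beta>. indecomposable_in (rat_adjoin {sqrt (real q)}) \<beta> \<longrightarrow>
        ((p mod 4 = 2 \<and> q mod 4 = 3) \<or> (p mod 4 = 2 \<and> q mod 4 = 1) \<or>
         (p mod 4 = 3 \<and> q mod 4 = 1) \<longrightarrow> indecomposable_in K \<beta>) \<and>
        (p mod 4 = 1 \<and> q mod 4 = 1 \<longrightarrow>
           (sqrt (real r) > sqrt (real q) \<and> is_omega_convergent q \<beta> \<longrightarrow> indecomposable_in K \<beta>) \<and>
           (sqrt (real r) > of_int (M_odd q) * sqrt (real q) \<longrightarrow> indecomposable_in K \<beta>))) \<and>
     (\<forall>\<gamma>. indecomposable_in (rat_adjoin {sqrt (real r)}) \<gamma> \<longrightarrow>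
        (is_omega_convergent r \<gamma> \<and> sqrt (real p) > sqrt (real r) \<longrightarrow> indecomposable_in K \<gamma>) \<and>
        (sqrt (real p) > of_int (M_odd r) * sqrt (real r) \<longrightarrow> indecomposable_in K \<gamma>))"
proof -
  define g where "g = gcd p q"
  have g: "g > 0" using assms(1) by (simp add: g_def)
  obtain p' q' where pq: "p = p' * g" "q = q' * g" "coprime p' q'"
    using gcd_coprime_exists[of p q] g unfolding g_def by auto
  have r: "r = p' * q'"
  proof -
    have "p * q = (p' * q') * g\<^sup>2" by (simp add: pq power2_eq_square)
    then show ?thesis using assms(7) g by (simp flip: g_def)
  qed
  have "squarefree p'" "squarefree q'"
    using assms(2,4) by (auto simp: pq dest: squarefree_multD)
  then have sqf_r: "squarefree r" unfolding r using pq(3) by (simp add: squarefree_mult_coprime)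
  have neq: "p \<noteq> 1" "q \<noteq> 1" "p \<noteq> q" using biquadratic_nondegenerate assms(5,6) by auto
  \<comment> \<open>\<open>r = 1\<close> would force \<open>p' = q' = 1\<close> and thus
    \<open>p = q\<close>.\<close>
  have "r \<noteq> 1" using neq(3) by (auto simp: r pq)
  have roots: "sqrt p * sqrt q = g * sqrt r" "sqrt q * sqrt p = g * sqrt r"
    "sqrt q * sqrt r = q' * sqrt p" "sqrt r * sqrt q = q' * sqrt p"
    by (rule sqrt_mult_sqrt; simp add: r pq power2_eq_square)+
  \<comment> \<open>In all four cases \<open>q\<close> is odd, hence so are its divisors
    \<open>g\<close> and \<open>q'\<close>, the factors that the lifting lemmas want odd.\<close>
  have "odd q"
  proof -
    have "q mod 4 = 1 \<or> q mod 4 = 3" using assms(8) by blast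
    then show ?thesis by presburger
  qed
  then have odd: "odd g" "odd q'" by (simp_all add: pq)
  have biq: "biquadratic p q r K"
    unfolding assms(5) by (rule biquadratic_rat_adjoin[OF assms(2,4) sqf_r neq(1,2) \<open>r \<noteq> 1\<close> g roots(1)])
  \<comment> \<open>In these three permutations the radicand of the subfield comes first and the one
    compared with it second: \<open>r\<close> for \<open>p\<close> and \<open>q\<close>, and
    \<open>p\<close> for \<open>r\<close>.\<close>
  interpret p: biquadratic p r q K using biquadratic_swap23[OF biq] .
  interpret q: biquadratic q r p K using biquadratic_swap23[OF biquadratic_swap12[OF biq]] .
  interpret r: biquadratic r p q K using biquadratic_swap12[OF p.biquadratic_axioms] .
  interpret biquadratic p q r K using biq .
  \<comment> \<open>The square of the odd \<open>g\<close> is 1 modulo 4, so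
    \<open>p * q = r * g\<^sup>2\<close> determines the residue of \<open>r\<close>.\<close>
  have r_mod: "r mod 4 = (p * q) mod 4"
  proof -
    obtain j where j: "g = 2 * j + 1" using odd(1) by (elim oddE)
    have "p * q = r * g\<^sup>2" by (simp add: r pq power2_eq_square)
    also have "\<dots> = r + 4 * (r * (j\<^sup>2 + j))" by (simp add: j power2_eq_square algebra_simps)
    finally show ?thesis by simp
  qed
  have cases: "p mod 4 = 2 \<and> q mod 4 = 3 \<and> r mod 4 = 2 \<or> p mod 4 = 2 \<and> q mod 4 = 1 \<and> r mod 4 = 2 \<or>
      p mod 4 = 3 \<and> q mod 4 = 1 \<and> r mod 4 = 3"
    if "(p mod 4 = 2 \<and> q mod 4 = 3) \<or> (p mod 4 = 2 \<and> q mod 4 = 1) \<or> (p mod 4 = 3 \<and> q mod 4 = 1)"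
    using that unfolding r_mod mod_mult_eq[of p 4 q, symmetric] by (elim disjE conjE) simp_all
  show ?thesis
    using p.indecomposable_lift[OF g roots(1) odd(1)] q.indecomposable_lift[OF g roots(2) odd(1)]
      r.indecomposable_lift[OF _ roots(4) odd(2)] odd_pos[OF odd(2)]
      indecomposable_lift_half_trace[OF roots(3) odd(2) cases]
    by blast
qed

end
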